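(* Let $G=Q_8\times A$, where $A$ is a finite abelian group, and let $*$ be the canonical involution of $G$ as an SLC-group, extended $\mathbb Q$-linearly to the group ring $\mathbb QG$. 1. If $G$ contains an element of prime order $p$ with $p\equiv 3 \pmod 8$ or $p\equiv 5\pmod 8$, then $\mathbb QG$ is not $*$-clean. 2. If $A\cong C_p$, where $p$ is a prime with $p\equiv 7\pmod 8$ and $C_p$ is the cyclic group of order $p$, then $\mathbb QG$ is $*$-clean.
   Context: $Q_8$ is the quaternion group of order $8$. An SLC-group is a group $G$ with $G/\mathcal Z(G)\cong C_2\times C_2$, where $\mathcal Z(G)$ is the center; then $G'=\{1,s\}$ with $s$ central of order $2$. Its canonical involution is the map $*:G\to G$ with $g^*=g$ if $g\in\mathcal Z(G)$ and $g^*=sg$ if $g\notin\mathcal Z(G)$. A projection is an element $p$ with $p^2=p=p^*$. A unital ring with involution $*$ is $*$-clean if each of its elements is the sum of a unit and a projection. *)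

theory Defs
  imports
    "HOL-Algebra.Elementary_Groups"
    "HOL-Algebra.Generated_Groups"
    "HOL-Algebra.Multiplicative_Group"
    "HOL-Library.Poly_Mapping"
    "HOL-Computational_Algebra.Primes"
begin

definition center :: "('g, 'm) monoid_scheme \<Rightarrow> 'g set" where
  "center G = {z \<in> carrier G. \<forall>g\<in>carrier G. z \<otimes>\<^bsub>G\<^esub> g = g \<otimes>\<^bsub>G\<^esub> z}"

locale slc_group = group G for G :: "('g, 'm) monoid_scheme" (structure) +
  assumes center_quotient: "G Mod center G \<cong> integer_mod_group 2 \<times>\<times> integer_mod_group 2"

definition slc_commutator :: "('g, 'm) monoid_scheme \<Rightarrow> 'g" where
  "slc_commutator G = (THE s. s \<noteq> \<one>\<^bsub>G\<^esub> \<and> derived G (carrier G) = {\<one>\<^bsub>G\<^esub>, s})"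

definition canonical_involution :: "('g, 'm) monoid_scheme \<Rightarrow> 'g \<Rightarrow> 'g" where
  "canonical_involution G g = (if g \<in> center G then g else slc_commutator G \<otimes>\<^bsub>G\<^esub> g)"

text \<open>
  Elements of the group ring are formal linear combinations, i.e. finitely supported
  functions whose support lies in the carrier of the group. The multiplication of
  \<^type>\<open>poly_mapping\<close> cannot be reused, since it refers to a type class instead of a carrier.
\<close>

definition group_ring :: "('g, 'm) monoid_scheme \<Rightarrow> ('g \<Rightarrow>\<^sub>0 'r::comm_ring_1) ring" where
  "group_ring G =
    \<lparr>carrier = {x. Poly_Mapping.keys x \<subseteq> carrier G},
     monoid.mult = (\<lambda>x y. \<Sum>g\<in>Poly_Mapping.keys x. \<Sum>h\<in>Poly_Mapping.keys y.
        Poly_Mapping.single (g \<otimes>\<^bsub>G\<^esub> h) (Poly_Mapping.lookup x g * Poly_Mapping.lookup y h)),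
     one = Poly_Mapping.single \<one>\<^bsub>G\<^esub> 1,
     zero = 0,
     add = (+)\<rparr>"

definition linear_extension :: "('g \<Rightarrow> 'h) \<Rightarrow> ('g \<Rightarrow>\<^sub>0 'r::comm_ring_1) \<Rightarrow> ('h \<Rightarrow>\<^sub>0 'r)" where
  "linear_extension f x =
     (\<Sum>g\<in>Poly_Mapping.keys x. Poly_Mapping.single (f g) (Poly_Mapping.lookup x g))"

locale involution_ring = ring R for R :: "('a, 'm) ring_scheme" (structure) +
  fixes star :: "'a \<Rightarrow> 'a"
  assumes star_closed: "x \<in> carrier R \<Longrightarrow> star x \<in> carrier R"
    and star_add: "\<lbrakk>x \<in> carrier R; y \<in> carrier R\<rbrakk> \<Longrightarrow> star (x \<oplus> y) = star x \<oplus> star y"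
    and star_mult: "\<lbrakk>x \<in> carrier R; y \<in> carrier R\<rbrakk> \<Longrightarrow> star (x \<otimes> y) = star y \<otimes> star x"
    and star_star: "x \<in> carrier R \<Longrightarrow> star (star x) = x"

definition projections :: "('a, 'm) ring_scheme \<Rightarrow> ('a \<Rightarrow> 'a) \<Rightarrow> 'a set" where
  "projections R star = {p \<in> carrier R. p \<otimes>\<^bsub>R\<^esub> p = p \<and> star p = p}"

text \<open>Only meaningful if \<^term>\<open>involution_ring R star\<close> holds.\<close>

definition star_clean :: "('a, 'm) ring_scheme \<Rightarrow> ('a \<Rightarrow> 'a) \<Rightarrow> bool" where
  "star_clean R star \<longleftrightarrow>
     (\<forall>x\<in>carrier R. \<exists>u\<in>Units R. \<exists>p\<in>projections R star. x = u \<oplus>\<^bsub>R\<^esub> p)"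

text \<open>The tuple \<open>(a, b, c, d)\<close> stands for the quaternion \<open>a + b i + c j + d k\<close>.\<close>

type_synonym quat = "int \<times> int \<times> int \<times> int"

fun quat_mult :: "quat \<Rightarrow> quat \<Rightarrow> quat" where
  "quat_mult (a, b, c, d) (a', b', c', d') =
     (a * a' - b * b' - c * c' - d * d',
      a * b' + b * a' + c * d' - d * c',
      a * c' - b * d' + c * a' + d * b',
      a * d' + b * c' - c * b' + d * a')"

definition Q8 :: "quat monoid" where
  "Q8 =
    \<lparr>carrier = {(1, 0, 0, 0), (-1, 0, 0, 0), (0, 1, 0, 0), (0, -1, 0, 0),
                (0, 0, 1, 0), (0, 0, -1, 0), (0, 0, 0, 1), (0, 0, 0, -1)},
     monoid.mult = quat_mult,
     one = (1, 0, 0, 0)\<rparr>"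


subsection \<open>The group ring is a ring\<close>

lemma group_ring_simps [simp]:
  "carrier (group_ring G) = {x. Poly_Mapping.keys x \<subseteq> carrier G}"
  "one (group_ring G) = Poly_Mapping.single \<one>\<^bsub>G\<^esub> 1"
  "zero (group_ring G) = 0"
  "add (group_ring G) = (+)"
  by (simp_all add: group_ring_def)

lemma linear_extension_superset:
  assumes "finite S" "Poly_Mapping.keys x \<subseteq> S"
  shows "linear_extension f x = (\<Sum>g\<in>S. Poly_Mapping.single (f g) (Poly_Mapping.lookup x g))"
  unfolding linear_extension_def
  by (rule sum.mono_neutral_left) (use assms in \<open>auto simp: in_keys_iff\<close>)

lemma linear_extension_add:
  "linear_extension f (x + y) = linear_extension f x + linear_extension f y"
proof -
  let ?S = "Poly_Mapping.keys x \<union> Poly_Mapping.keys y"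
  have "Poly_Mapping.keys (x + y) \<subseteq> ?S"
    by (rule Poly_Mapping.keys_add)
  then show ?thesis
    by (simp add: linear_extension_superset[of ?S] lookup_add single_add sum.distrib)
qed

lemma linear_extension_0 [simp]: "linear_extension f 0 = 0"
  by (simp add: linear_extension_def)

lemma linear_extension_sum:
  "linear_extension f (\<Sum>i\<in>I. x i) = (\<Sum>i\<in>I. linear_extension f (x i))"
  by (induction I rule: infinite_finite_induct) (simp_all add: linear_extension_add)

lemma linear_extension_single [simp]:
  "linear_extension f (Poly_Mapping.single g r) = Poly_Mapping.single (f g) r"
  by (simp add: linear_extension_def)

lemma linear_extension_keys:
  assumes "\<And>g. g \<in> Poly_Mapping.keys x \<Longrightarrow> f g \<in> S"
  shows "Poly_Mapping.keys (linear_extension f x) \<subseteq> S"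
  unfolding linear_extension_def
  by (rule order.trans[OF Poly_Mapping.keys_sum]) (use assms in \<open>auto split: if_splits\<close>)

lemma sum_singles:
  "(\<Sum>g\<in>Poly_Mapping.keys x. Poly_Mapping.single g (Poly_Mapping.lookup x g)) = x"
  by (rule poly_mapping_eqI)
    (auto simp: lookup_sum lookup_single when_def in_keys_iff sum.delta[OF finite_keys])

lemma group_ring_mult:
  "monoid.mult (group_ring G) x y = (\<Sum>g\<in>Poly_Mapping.keys x. \<Sum>h\<in>Poly_Mapping.keys y.
      Poly_Mapping.single (g \<otimes>\<^bsub>G\<^esub> h) (Poly_Mapping.lookup x g * Poly_Mapping.lookup y h))"
  by (simp add: group_ring_def)

lemma group_ring_mult_superset:
  assumes "finite S" "Poly_Mapping.keys x \<subseteq> S" "finite T" "Poly_Mapping.keys y \<subseteq> T"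
  shows "monoid.mult (group_ring G) x y = (\<Sum>g\<in>S. \<Sum>h\<in>T.
      Poly_Mapping.single (g \<otimes>\<^bsub>G\<^esub> h) (Poly_Mapping.lookup x g * Poly_Mapping.lookup y h))"
proof -
  have "monoid.mult (group_ring G) x y = (\<Sum>g\<in>Poly_Mapping.keys x. \<Sum>h\<in>T.
      Poly_Mapping.single (g \<otimes>\<^bsub>G\<^esub> h) (Poly_Mapping.lookup x g * Poly_Mapping.lookup y h))"
    unfolding group_ring_mult
    by (intro sum.cong[OF refl] sum.mono_neutral_left) (use assms in \<open>auto simp: in_keys_iff\<close>)
  also have "\<dots> = (\<Sum>g\<in>S. \<Sum>h\<in>T.
      Poly_Mapping.single (g \<otimes>\<^bsub>G\<^esub> h) (Poly_Mapping.lookup x g * Poly_Mapping.lookup y h))"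
    by (rule sum.mono_neutral_left) (use assms in \<open>auto simp: in_keys_iff\<close>)
  finally show ?thesis .
qed

lemma group_ring_distrib_right:
  "monoid.mult (group_ring G) (x + y) z = monoid.mult (group_ring G) x z + monoid.mult (group_ring G) y z"
proof -
  let ?S = "Poly_Mapping.keys x \<union> Poly_Mapping.keys y"
  have "Poly_Mapping.keys (x + y) \<subseteq> ?S"
    by (rule Poly_Mapping.keys_add)
  then show ?thesis
    by (simp add: group_ring_mult_superset[of ?S _ "Poly_Mapping.keys z"] lookup_add
        distrib_right single_add sum.distrib)
qed

lemma group_ring_distrib_left:
  "monoid.mult (group_ring G) z (x + y) = monoid.mult (group_ring G) z x + monoid.mult (group_ring G) z y"
proof -
  let ?S = "Poly_Mapping.keys x \<union> Poly_Mapping.keys y"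
  have "Poly_Mapping.keys (x + y) \<subseteq> ?S"
    by (rule Poly_Mapping.keys_add)
  then show ?thesis
    by (simp add: group_ring_mult_superset[of "Poly_Mapping.keys z" _ ?S] lookup_add
        distrib_left single_add sum.distrib)
qed

lemma group_ring_mult_0 [simp]:
  "monoid.mult (group_ring G) 0 x = 0" "monoid.mult (group_ring G) x 0 = 0"
  by (simp_all add: group_ring_mult)

lemma group_ring_mult_single [simp]:
  "monoid.mult (group_ring G) (Poly_Mapping.single g r) (Poly_Mapping.single h s) =
     Poly_Mapping.single (g \<otimes>\<^bsub>G\<^esub> h) (r * s)"
  by (cases "r = 0"; cases "s = 0") (simp_all add: group_ring_mult)

lemma group_ring_induct [consumes 1, case_names zero single add]:
  fixes x :: "'g \<Rightarrow>\<^sub>0 'r::comm_ring_1"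
  assumes "Poly_Mapping.keys x \<subseteq> S" "P 0"
    "\<And>g r. g \<in> S \<Longrightarrow> P (Poly_Mapping.single g r)"
    "\<And>x y. \<lbrakk>P x; P y\<rbrakk> \<Longrightarrow> P (x + y)"
  shows "P x"
proof -
  have "P (\<Sum>g\<in>T. Poly_Mapping.single g (Poly_Mapping.lookup x g))" if "finite T" "T \<subseteq> S" for T
    using that by (induction T rule: finite_induct) (auto intro: assms(2-4))
  from this[OF finite_keys assms(1)] show ?thesis
    by (simp add: sum_singles)
qed

lemma ring_group_ring:
  assumes "monoid G"
  shows "ring (group_ring G :: ('g \<Rightarrow>\<^sub>0 'r::comm_ring_1) ring)"
proof -
  interpret monoid G by fact
  let ?R = "group_ring G :: ('g \<Rightarrow>\<^sub>0 'r) ring"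
  have "abelian_group ?R"
  proof (rule abelian_groupI)
    fix x assume "x \<in> carrier ?R"
    then show "\<exists>y\<in>carrier ?R. y \<oplus>\<^bsub>?R\<^esub> x = \<zero>\<^bsub>?R\<^esub>"
      by (intro bexI[of _ "- x"]) auto
  qed (use Poly_Mapping.keys_add in \<open>force simp: add_ac\<close>)+
  moreover have closed: "Poly_Mapping.keys (x \<otimes>\<^bsub>?R\<^esub> y) \<subseteq> carrier G"
    if "Poly_Mapping.keys x \<subseteq> carrier G" "Poly_Mapping.keys y \<subseteq> carrier G" for x y
    unfolding group_ring_mult
    by (intro order.trans[OF Poly_Mapping.keys_sum] UN_least) (use that in \<open>auto split: if_splits\<close>)
  have one: "\<one>\<^bsub>?R\<^esub> \<otimes>\<^bsub>?R\<^esub> x = x \<and> x \<otimes>\<^bsub>?R\<^esub> \<one>\<^bsub>?R\<^esub> = x" if "Poly_Mapping.keys x \<subseteq> carrier G" for x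
    using that by (induction rule: group_ring_induct)
      (simp_all add: group_ring_distrib_left group_ring_distrib_right)
  have assoc: "(x \<otimes>\<^bsub>?R\<^esub> y) \<otimes>\<^bsub>?R\<^esub> z = x \<otimes>\<^bsub>?R\<^esub> (y \<otimes>\<^bsub>?R\<^esub> z)"
    if "Poly_Mapping.keys x \<subseteq> carrier G" and y: "Poly_Mapping.keys y \<subseteq> carrier G"
      and z: "Poly_Mapping.keys z \<subseteq> carrier G" for x y z
    using that(1)
  proof (induction rule: group_ring_induct)
    case (single g r)
    note g = single
    show ?case using y
    proof (induction rule: group_ring_induct)
      case (single h s)
      note h = single
      show ?case using z
        by (induction rule: group_ring_induct)
          (use g h in \<open>simp_all add: m_assoc mult.assoc group_ring_distrib_left\<close>)
    qed (simp_all add: group_ring_distrib_left group_ring_distrib_right)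
  qed (simp_all add: group_ring_distrib_right)
  have "monoid ?R"
    by (rule monoidI) (use closed one assoc in \<open>auto\<close>)
  ultimately show ?thesis
    by (rule ringI) (simp_all add: group_ring_distrib_left group_ring_distrib_right)
qed

lemma involution_ring_group_ring:
  fixes f :: "'g \<Rightarrow> 'g"
  assumes "monoid G"
    and closed: "\<And>g. g \<in> carrier G \<Longrightarrow> f g \<in> carrier G"
    and inv: "\<And>g. g \<in> carrier G \<Longrightarrow> f (f g) = g"
    and anti: "\<And>g h. \<lbrakk>g \<in> carrier G; h \<in> carrier G\<rbrakk> \<Longrightarrow> f (g \<otimes>\<^bsub>G\<^esub> h) = f h \<otimes>\<^bsub>G\<^esub> f g"
  shows "involution_ring (group_ring G :: ('g \<Rightarrow>\<^sub>0 'r::comm_ring_1) ring) (linear_extension f)"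
proof (intro involution_ring.intro ring_group_ring involution_ring_axioms.intro)
  let ?R = "group_ring G :: ('g \<Rightarrow>\<^sub>0 'r) ring"
  fix x assume "x \<in> carrier ?R"
  then have x: "Poly_Mapping.keys x \<subseteq> carrier G" by simp
  show "linear_extension f x \<in> carrier ?R"
    using linear_extension_keys[of x f "carrier G"] closed x by auto
  show "linear_extension f (linear_extension f x) = x"
    using x by (induction rule: group_ring_induct) (simp_all add: inv linear_extension_add)
  fix y assume "y \<in> carrier ?R"
  then have y: "Poly_Mapping.keys y \<subseteq> carrier G" by simp
  show "linear_extension f (x \<oplus>\<^bsub>?R\<^esub> y) = linear_extension f x \<oplus>\<^bsub>?R\<^esub> linear_extension f y"
    by (simp add: linear_extension_add)
  show "linear_extension f (x \<otimes>\<^bsub>?R\<^esub> y) = linear_extension f y \<otimes>\<^bsub>?R\<^esub> linear_extension f x"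
    using x
  proof (induction rule: group_ring_induct)
    case (single g r)
    note g = single
    show ?case
      using y by (induction rule: group_ring_induct)
        (use g in \<open>simp_all add: anti mult.commute linear_extension_add
          group_ring_distrib_left group_ring_distrib_right\<close>)
  qed (simp_all add: linear_extension_add group_ring_distrib_left group_ring_distrib_right)
qed fact


subsection \<open>The direct product of \<open>Q\<^sub>8\<close> with an abelian group is an SLC-group\<close>

lemma quat_mult_assoc: "quat_mult (quat_mult x y) z = quat_mult x (quat_mult y z)"
  by (cases x; cases y; cases z) (simp add: algebra_simps)

lemma group_Q8: "group Q8"
proof (rule groupI)
  fix x assume "x \<in> carrier Q8"
  then show "\<exists>y\<in>carrier Q8. y \<otimes>\<^bsub>Q8\<^esub> x = \<one>\<^bsub>Q8\<^esub>"
    by (cases x; intro bexI[of _ "(fst x, - fst (snd x), - fst (snd (snd x)), - snd (snd (snd x)))"])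
      (auto simp: Q8_def)
next
  fix x y z
  show "x \<otimes>\<^bsub>Q8\<^esub> y \<otimes>\<^bsub>Q8\<^esub> z = x \<otimes>\<^bsub>Q8\<^esub> (y \<otimes>\<^bsub>Q8\<^esub> z)"
    by (simp add: Q8_def quat_mult_assoc)
qed (auto simp: Q8_def)

context
  fixes A :: "('a, 'm) monoid_scheme"
  assumes A: "comm_group A"
begin

interpretation A: comm_group A by (fact A)

interpretation G: group "Q8 \<times>\<times> A"
  by (intro DirProd_group group_Q8 A.is_group)

lemma center_Q8_times: "center (Q8 \<times>\<times> A) = {(1, 0, 0, 0), (-1, 0, 0, 0)} \<times> carrier A"
proof (intro equalityI subsetI)
  fix z assume z: "z \<in> center (Q8 \<times>\<times> A)"
  obtain q x where z_eq: "z = (q, x)" by (cases z)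
  have mem: "q \<in> carrier Q8" "x \<in> carrier A"
    using z by (auto simp: center_def z_eq)
  have "quat_mult q h = quat_mult h q" if "h \<in> carrier Q8" for h
  proof -
    have "(h, \<one>\<^bsub>A\<^esub>) \<in> carrier (Q8 \<times>\<times> A)"
      using that by simp
    then have "z \<otimes>\<^bsub>Q8 \<times>\<times> A\<^esub> (h, \<one>\<^bsub>A\<^esub>) = (h, \<one>\<^bsub>A\<^esub>) \<otimes>\<^bsub>Q8 \<times>\<times> A\<^esub> z"
      using z unfolding center_def by blast
    then show ?thesis
      by (simp add: z_eq Q8_def)
  qed
  from this[of "(0, 1, 0, 0)"] this[of "(0, 0, 1, 0)"]
  show "z \<in> {(1, 0, 0, 0), (-1, 0, 0, 0)} \<times> carrier A"
    using mem by (auto simp: Q8_def z_eq)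
next
  fix z :: "quat \<times> 'a" assume z: "z \<in> {(1, 0, 0, 0), (-1, 0, 0, 0)} \<times> carrier A"
  have "z \<otimes>\<^bsub>Q8 \<times>\<times> A\<^esub> g = g \<otimes>\<^bsub>Q8 \<times>\<times> A\<^esub> z" if "g \<in> carrier (Q8 \<times>\<times> A)" for g
  proof -
    obtain a b c d x where g: "g = ((a, b, c, d), x)" by (metis surj_pair)
    then have "x \<in> carrier A" using that by simp
    then show ?thesis
      using z by (cases z) (auto simp: g Q8_def A.m_comm)
  qed
  then show "z \<in> center (Q8 \<times>\<times> A)"
    using z by (auto simp: center_def Q8_def)
qed

lemma slc_group_Q8_times: "slc_group (Q8 \<times>\<times> A)"
proof
  let ?G = "Q8 \<times>\<times> A" and ?K = "integer_mod_group 2 \<times>\<times> integer_mod_group 2"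
  define q :: "quat \<Rightarrow> int \<times> int"
    where "q = (\<lambda>(a, b, c, d). (b * b + d * d, c * c + d * d))"
  define f :: "quat \<times> 'a \<Rightarrow> int \<times> int" where "f = q \<circ> fst"
  have K: "carrier ?K = {0, 1} \<times> {0, 1}"
    by (auto simp: integer_mod_group_def)
  have q: "q ` carrier Q8 = {0, 1} \<times> {0, 1}"
    by (auto simp: Q8_def q_def)
  have q_mult: "\<forall>x\<in>carrier Q8. \<forall>y\<in>carrier Q8. q (quat_mult x y) = q x \<otimes>\<^bsub>?K\<^esub> q y"
    by (simp add: Q8_def q_def)
  have q_ker: "\<forall>x\<in>carrier Q8. q x = (0, 0) \<longleftrightarrow> x \<in> {(1, 0, 0, 0), (-1, 0, 0, 0)}"
    by (simp add: Q8_def q_def)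
  have image: "f ` carrier ?G = carrier ?K"
    unfolding f_def K image_comp [symmetric] q [symmetric] by (auto simp: image_iff)
  have "f \<in> hom ?G ?K"
  proof (rule homI)
    fix x assume "x \<in> carrier ?G"
    then show "f x \<in> carrier ?K" using image by blast
  next
    fix x y assume "x \<in> carrier ?G" "y \<in> carrier ?G"
    then have "fst x \<in> carrier Q8" "fst y \<in> carrier Q8" by auto
    moreover have "fst (x \<otimes>\<^bsub>?G\<^esub> y) = quat_mult (fst x) (fst y)"
      by (cases x; cases y) (simp add: Q8_def)
    ultimately show "f (x \<otimes>\<^bsub>?G\<^esub> y) = f x \<otimes>\<^bsub>?K\<^esub> f y"
      using q_mult by (simp add: f_def)
  qed
  then interpret f: group_hom ?G ?K f
    by (intro group_hom.intro G.is_group DirProd_group group_integer_mod_group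
        group_hom_axioms.intro)
  have "kernel ?G ?K f = {x \<in> carrier ?G. q (fst x) = (0, 0)}"
    by (simp add: kernel_def f_def)
  also have "\<dots> = {x \<in> carrier ?G. fst x \<in> {(1, 0, 0, 0), (-1, 0, 0, 0)}}"
    using q_ker by (intro Collect_cong) auto
  also have "\<dots> = center ?G"
    unfolding center_Q8_times by (auto simp: Q8_def)
  finally show "?G Mod center ?G \<cong> ?K"
    using f.FactGroup_iso[OF image] by simp
qed

lemma slc_commutator_Q8_times: "slc_commutator (Q8 \<times>\<times> A) = ((-1, 0, 0, 0), \<one>\<^bsub>A\<^esub>)"
proof -
  let ?G = "Q8 \<times>\<times> A"
  define s where "s = (((-1, 0, 0, 0), \<one>\<^bsub>A\<^esub>) :: quat \<times> 'a)"
  define comm where "comm = (\<lambda>g h. g \<otimes>\<^bsub>?G\<^esub> h \<otimes>\<^bsub>?G\<^esub> inv\<^bsub>?G\<^esub> g \<otimes>\<^bsub>?G\<^esub> inv\<^bsub>?G\<^esub> h)"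
  define conj :: "quat \<Rightarrow> quat" where "conj = (\<lambda>(a, b, c, d). (a, -b, -c, -d))"
  define qcomm where "qcomm = (\<lambda>x y. quat_mult (quat_mult (quat_mult x y) (conj x)) (conj y))"
  have conj: "\<forall>x\<in>carrier Q8. conj x \<in> carrier Q8 \<and> conj x \<otimes>\<^bsub>Q8\<^esub> x = \<one>\<^bsub>Q8\<^esub>"
    by (simp add: Q8_def conj_def)
  interpret Q8: group Q8 by (rule group_Q8)
  have inv_Q8: "inv\<^bsub>Q8\<^esub> x = conj x" if "x \<in> carrier Q8" for x
    using that conj by (intro Q8.inv_equality) simp_all
  have qcomm: "\<forall>x\<in>carrier Q8. \<forall>y\<in>carrier Q8. qcomm x y \<in> {(1, 0, 0, 0), (-1, 0, 0, 0)}"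
    by (simp add: Q8_def qcomm_def conj_def)
  have inv_A: "x \<otimes>\<^bsub>A\<^esub> y \<otimes>\<^bsub>A\<^esub> inv\<^bsub>A\<^esub> x \<otimes>\<^bsub>A\<^esub> inv\<^bsub>A\<^esub> y = \<one>\<^bsub>A\<^esub>"
    if "x \<in> carrier A" "y \<in> carrier A" for x y
    using that by (metis A.inv_closed A.m_assoc A.m_closed A.m_comm A.r_inv A.r_one)
  have comm: "comm (x, u) (y, v) = (qcomm x y, \<one>\<^bsub>A\<^esub>)"
    if "x \<in> carrier Q8" "u \<in> carrier A" "y \<in> carrier Q8" "v \<in> carrier A" for x u y v
  proof -
    have "comm (x, u) (y, v) = (x \<otimes>\<^bsub>Q8\<^esub> y \<otimes>\<^bsub>Q8\<^esub> inv\<^bsub>Q8\<^esub> x \<otimes>\<^bsub>Q8\<^esub> inv\<^bsub>Q8\<^esub> y, \<one>\<^bsub>A\<^esub>)"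
      using that by (simp add: comm_def inv_DirProd[OF group_Q8 A.is_group] inv_A)
    then show ?thesis
      using that by (simp add: inv_Q8) (simp add: qcomm_def Q8_def)
  qed
  have one: "\<one>\<^bsub>?G\<^esub> = ((1, 0, 0, 0), \<one>\<^bsub>A\<^esub>)"
    by (simp add: Q8_def)
  have mem: "s \<in> carrier ?G"
    by (simp add: s_def Q8_def)
  have ij: "(0, 1, 0, 0) \<in> carrier Q8" "(0, 0, 1, 0) \<in> carrier Q8"
    by (simp_all add: Q8_def)
  have sub: "derived_set ?G (carrier ?G) \<subseteq> {\<one>\<^bsub>?G\<^esub>, s}"
  proof -
    have "comm g h \<in> {\<one>\<^bsub>?G\<^esub>, s}" if "g \<in> carrier ?G" "h \<in> carrier ?G" for g h
    proof -
      obtain x u y v where gh: "g = (x, u)" "h = (y, v)" by (metis surj_pair)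
      then have "x \<in> carrier Q8" "u \<in> carrier A" "y \<in> carrier Q8" "v \<in> carrier A"
        using that by auto
      with comm[OF this] qcomm show ?thesis
        unfolding gh one s_def by auto
    qed
    then show ?thesis
      unfolding comm_def by blast
  qed
  have "comm ((0, 1, 0, 0), \<one>\<^bsub>A\<^esub>) ((0, 0, 1, 0), \<one>\<^bsub>A\<^esub>) = s"
    by (subst comm) (use ij in \<open>simp_all add: s_def qcomm_def conj_def\<close>)
  moreover have "((0, 1, 0, 0), \<one>\<^bsub>A\<^esub>) \<in> carrier ?G" "((0, 0, 1, 0), \<one>\<^bsub>A\<^esub>) \<in> carrier ?G"
    using ij by simp_all
  ultimately have s: "s \<in> derived_set ?G (carrier ?G)"
    unfolding comm_def by (metis (no_types, lifting) UN_I singletonI)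
  have ss: "s \<otimes>\<^bsub>?G\<^esub> s = \<one>\<^bsub>?G\<^esub>"
    by (simp add: s_def Q8_def)
  then have "inv\<^bsub>?G\<^esub> s = s"
    using mem by (rule G.inv_equality) (rule mem)
  then have "subgroup {\<one>\<^bsub>?G\<^esub>, s} ?G"
    using mem ss G.one_closed G.l_one G.r_one G.inv_one
    by (intro G.subgroupI) (auto simp del: mult_DirProd one_DirProd carrier_DirProd)
  then have "generate ?G (derived_set ?G (carrier ?G)) \<subseteq> {\<one>\<^bsub>?G\<^esub>, s}"
    by (rule G.generate_subgroup_incl[OF sub])
  moreover have "{\<one>\<^bsub>?G\<^esub>, s} \<subseteq> generate ?G (derived_set ?G (carrier ?G))"
    by (intro insert_subsetI empty_subsetI generate.one generate.incl s)
  ultimately have derived: "derived ?G (carrier ?G) = {\<one>\<^bsub>?G\<^esub>, s}"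
    unfolding derived_def by blast
  have "s \<noteq> \<one>\<^bsub>?G\<^esub>"
    by (simp add: s_def Q8_def)
  then have "slc_commutator ?G = s"
    unfolding slc_commutator_def derived by (intro the_equality) (auto simp: doubleton_eq_iff)
  then show ?thesis
    by (simp add: s_def)
qed

text \<open>On this group, the canonical involution is quaternion conjugation in the first component.\<close>

lemma canonical_involution_Q8_times:
  assumes "((a, b, c, d), x) \<in> carrier (Q8 \<times>\<times> A)"
  shows "canonical_involution (Q8 \<times>\<times> A) ((a, b, c, d), x) = ((a, -b, -c, -d), x)"
  using assms
  by (auto simp: canonical_involution_def center_Q8_times slc_commutator_Q8_times)
     (auto simp: DirProd_def Q8_def)

lemma involution_ring_Q8_times:
  "involution_ring (group_ring (Q8 \<times>\<times> A) :: (quat \<times> 'a \<Rightarrow>\<^sub>0 'r::comm_ring_1) ring)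
     (linear_extension (canonical_involution (Q8 \<times>\<times> A)))"
proof (rule involution_ring_group_ring)
  have closed: "((a, -b, -c, -d), x) \<in> carrier (Q8 \<times>\<times> A)"
    if "((a, b, c, d), x) \<in> carrier (Q8 \<times>\<times> A)" for a b c d x
    using that by (auto simp: DirProd_def Q8_def)
  fix g assume g: "g \<in> carrier (Q8 \<times>\<times> A)"
  obtain a b c d x where g_eq: "g = ((a, b, c, d), x)" by (metis surj_pair)
  show "canonical_involution (Q8 \<times>\<times> A) g \<in> carrier (Q8 \<times>\<times> A)"
    using closed[OF g[unfolded g_eq]] canonical_involution_Q8_times[OF g[unfolded g_eq]]
    unfolding g_eq by (simp only:)
  show "canonical_involution (Q8 \<times>\<times> A) (canonical_involution (Q8 \<times>\<times> A) g) = g"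
    using canonical_involution_Q8_times[OF g[unfolded g_eq]]
      canonical_involution_Q8_times[OF closed[OF g[unfolded g_eq]]]
    unfolding g_eq by (simp only: minus_minus)
  fix h assume h: "h \<in> carrier (Q8 \<times>\<times> A)"
  obtain a' b' c' d' y where h_eq: "h = ((a', b', c', d'), y)" by (metis surj_pair)
  have xy: "x \<in> carrier A" "y \<in> carrier A"
    using g h by (auto simp: g_eq h_eq DirProd_def)
  obtain a'' b'' c'' d'' z where gh_eq: "g \<otimes>\<^bsub>Q8 \<times>\<times> A\<^esub> h = ((a'', b'', c'', d''), z)"
    by (metis surj_pair)
  have "canonical_involution (Q8 \<times>\<times> A) (g \<otimes>\<^bsub>Q8 \<times>\<times> A\<^esub> h) = ((a'', -b'', -c'', -d''), z)"
    using canonical_involution_Q8_times[of a'' b'' c'' d'' z] G.m_closed[OF g h]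
    unfolding gh_eq by blast
  also have "\<dots> = canonical_involution (Q8 \<times>\<times> A) h \<otimes>\<^bsub>Q8 \<times>\<times> A\<^esub> canonical_involution (Q8 \<times>\<times> A) g"
    using gh_eq canonical_involution_Q8_times[OF g[unfolded g_eq]]
      canonical_involution_Q8_times[OF h[unfolded h_eq]] A.m_comm[OF xy]
    unfolding g_eq h_eq by (simp add: Q8_def algebra_simps)
  finally show "canonical_involution (Q8 \<times>\<times> A) (g \<otimes>\<^bsub>Q8 \<times>\<times> A\<^esub> h) =
    canonical_involution (Q8 \<times>\<times> A) h \<otimes>\<^bsub>Q8 \<times>\<times> A\<^esub> canonical_involution (Q8 \<times>\<times> A) g" .
qed (rule G.is_monoid)

end

end

theory Submission
  imports Defs "HOL-Number_Theory.Gauss" "HOL-Library.Z2"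
begin

text \<open>
  The four characters of \<open>Q\<^sub>8\<close> with values \<open>\<plusminus>1\<close> and the embedding of \<open>Q\<^sub>8\<close> into the
  quaternions identify the rational group ring of \<open>Q\<^sub>8 \<times> A\<close> with four copies of \<open>\<rat>A\<close> and one copy of
  the quaternion algebra over \<open>\<rat>A\<close>, and \<open>*\<close> becomes the identity on the former and quaternion
  conjugation on the latter. In the quaternion algebra a projection has no imaginary part. So everything
  depends on whether sums of squares in \<open>\<rat>A\<close> can vanish.

  For \<open>p \<equiv> 3, 5 (mod 8)\<close>, 2 is a quadratic nonresidue, that is, \<open>2^((p - 1) / 2) \<equiv> -1 (mod p)\<close>.
  For \<open>a \<in> A\<close> of order \<open>p\<close>, the product of the sums of two squares \<open>1 + a^(2^i)\<close> then
  telescopes and shows that \<open>-1 = u^2 + v^2\<close> after multiplication by \<open>1 - a\<close>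
  (\<open>minus_one_sum_of_two_squares\<close>). Subtracting a projection from \<open>(1 + u i + v j) / 2\<close> always
  leaves an element whose norm is killed by \<open>1 - a\<close>, whereas units have invertible norms
  (\<open>not_star_clean_if_two_squares\<close>).

  For \<open>p \<equiv> 7 (mod 8)\<close>, \<open>f = (p - 1) / 2\<close> is odd and \<open>2^f \<equiv> 1 (mod p)\<close>. Then a 2-adic descent
  in \<open>\<int>A\<close> shows that a sum of three squares in \<open>\<rat>A\<close> vanishes only trivially
  (\<open>three_squares_anisotropic\<close>). Therefore the group ring has no nonzero nilpotent elements
  (\<open>reduced_Q8_times\<close>). Since it is finite-dimensional, each element is a unit on the corner
  of a central idempotent \<open>e\<close> and zero on the other corner, and central idempotents are fixed
  by \<open>*\<close>. So subtracting \<open>1 - e\<close> leaves a unit (\<open>star_clean_if_reduced\<close>).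
\<close>

section \<open>The quadratic character of 2\<close>

text \<open>
  Gauss's lemma for \<open>a = 2\<close>: among the residues \<open>2, 4, \<dots>, p - 1\<close>, those exceeding
  \<open>(p - 1) / 2\<close> are the doubles of the numbers in the upper half of \<open>1, \<dots>, (p - 1) / 2\<close>.
\<close>

lemma two_power_half_cong:
  fixes p :: nat
  assumes "prime p" "2 < p"
  shows "[2 ^ ((p - 1) div 2) = (-1) ^ ((p - 1) div 2 - (p - 1) div 4)] (mod int p)"
proof -
  interpret GAUSS p 2
    using assms by unfold_locales (auto simp: cong_def)
  define m where "m = (int p - 1) div 2"
  have p: "int p = 2 * m + 1"
    using p_eq2 by (simp add: m_def)
  have "C = (\<lambda>x. 2 * x) ` {0<..m}"
    unfolding C_def B_def A_def image_image
    by (intro image_cong) (auto simp: p m_def[symmetric])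
  then have "E = (\<lambda>x. 2 * x) ` {m div 2<..m}"
    by (auto simp: E_def m_def[symmetric])
  then have "card E = nat m - nat m div 2"
    by (simp add: card_image inj_on_def nat_div_distrib nat_diff_distrib p)
  moreover have "nat m = (p - 1) div 2"
    using p by linarith
  moreover have "(p - 1) div 2 div 2 = (p - 1) div 4"
    by (simp add: div_mult2_eq[symmetric])
  ultimately show ?thesis
    using pre_gauss_lemma by (simp add: m_def[symmetric])
qed

lemma dvd_two_power_half_plus_1:
  fixes p :: nat
  assumes "prime p" "p mod 8 = 3 \<or> p mod 8 = 5"
  shows "p dvd 2 ^ ((p - 1) div 2) + 1"
proof -
  define k where "k = p div 8"
  have p: "p = 8 * k + 3 \<or> p = 8 * k + 5"
    using assms(2) mult_div_mod_eq[of 8 p] unfolding k_def by metis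
  then have "odd ((p - 1) div 2 - (p - 1) div 4)"
  proof
    assume p: "p = 8 * k + 3"
    have "(p - 1) div 2 = 4 * k + 1" "(p - 1) div 4 = 2 * k"
      by (rule div_nat_eqI; simp add: p)+
    then show ?thesis by simp
  next
    assume p: "p = 8 * k + 5"
    have "(p - 1) div 2 = 4 * k + 2" "(p - 1) div 4 = 2 * k + 1"
      by (rule div_nat_eqI; simp add: p)+
    then show ?thesis by simp
  qed
  moreover have "2 < p" using p by auto
  ultimately have "[2 ^ ((p - 1) div 2) = -1] (mod int p)"
    using two_power_half_cong[OF assms(1)] by simp
  then have "int p dvd int (2 ^ ((p - 1) div 2) + 1)"
    by (simp add: cong_iff_dvd_diff add.commute)
  then show ?thesis by (simp only: int_dvd_int_iff)
qed

lemma dvd_two_power_half_minus_1: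
  fixes p :: nat
  assumes "prime p" "p mod 8 = 7"
  shows "p dvd 2 ^ ((p - 1) div 2) - 1"
proof -
  define k where "k = p div 8"
  have p: "p = 8 * k + 7"
    using assms(2) mult_div_mod_eq[of 8 p] unfolding k_def by metis
  have "(p - 1) div 2 = 4 * k + 3" "(p - 1) div 4 = 2 * k + 1"
    by (rule div_nat_eqI; simp add: p)+
  then have "even ((p - 1) div 2 - (p - 1) div 4)"
    by simp
  moreover have "2 < p" using p by auto
  ultimately have "[2 ^ ((p - 1) div 2) = 1] (mod int p)"
    using two_power_half_cong[OF assms(1)] by simp
  then have "int p dvd int (2 ^ ((p - 1) div 2) - 1)"
    by (simp add: cong_iff_dvd_diff of_nat_diff)
  then show ?thesis by (simp only: int_dvd_int_iff)
qed

section \<open>Sums of squares in commutative rings\<close>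

context cring begin

lemma two_squares_mult:
  assumes "a \<in> carrier R" "b \<in> carrier R" "c \<in> carrier R" "d \<in> carrier R"
  shows "(a \<otimes> a \<oplus> b \<otimes> b) \<otimes> (c \<otimes> c \<oplus> d \<otimes> d) =
    (a \<otimes> c \<ominus> b \<otimes> d) \<otimes> (a \<otimes> c \<ominus> b \<otimes> d) \<oplus> (a \<otimes> d \<oplus> b \<otimes> c) \<otimes> (a \<otimes> d \<oplus> b \<otimes> c)"
  using assms by algebra


text \<open>
  The quotient \<open>(1 - a^(2^t)) / (1 - a)\<close> telescopes to the product of the factors
  \<open>1 + a^(2^i)\<close> with \<open>i < t\<close>. As \<open>a\<close> has odd order, \<open>a^(2^i)\<close> is a square, so that each factor is
  a sum of two squares, and so is their product.
\<close>

lemma one_minus_two_power_eq_sum_of_two_squares: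
  assumes a: "a \<in> carrier R" "a [^] (p::nat) = \<one>" and p: "odd p"
  shows "\<exists>u\<in>carrier R. \<exists>v\<in>carrier R.
    (\<one> \<ominus> a) \<otimes> (u \<otimes> u \<oplus> v \<otimes> v) = \<one> \<ominus> a [^] ((2::nat) ^ t)"
proof (induction t)
  case 0
  show ?case
    by (intro bexI[of _ \<one>] bexI[of _ \<zero>]) (use a in \<open>simp_all add: nat_pow_Suc2\<close>)
next
  case (Suc t)
  then obtain u v where uv: "u \<in> carrier R" "v \<in> carrier R"
    "(\<one> \<ominus> a) \<otimes> (u \<otimes> u \<oplus> v \<otimes> v) = \<one> \<ominus> a [^] ((2::nat) ^ t)"
    by blast
  define x where "x = a [^] ((2::nat) ^ t)"
  \<comment> \<open>a square root of \<open>x\<close>, since \<open>x^p = 1\<close>\<close>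
  define b where "b = x [^] ((p + 1) div 2)"
  have x: "x \<in> carrier R" and b: "b \<in> carrier R"
    using a by (simp_all add: x_def b_def)
  have half: "(p + 1) div 2 + (p + 1) div 2 = p + 1"
    using p by presburger
  then have "b \<otimes> b = x [^] (p + 1)"
    using x by (simp only: b_def nat_pow_mult)
  also have "\<dots> = x"
    using a x by (simp add: x_def nat_pow_pow mult.commute[of _ p]) (simp add: nat_pow_pow[symmetric])
  finally have bb: "b \<otimes> b = x" .
  have "\<one> \<ominus> a [^] ((2::nat) ^ Suc t) = \<one> \<ominus> x \<otimes> x"
    using a by (simp add: x_def nat_pow_mult mult_2)
  also have "\<dots> = (\<one> \<ominus> x) \<otimes> (\<one> \<otimes> \<one> \<oplus> x)"
    using x by algebra
  also have "\<dots> = (\<one> \<ominus> a) \<otimes> ((u \<otimes> u \<oplus> v \<otimes> v) \<otimes> (\<one> \<otimes> \<one> \<oplus> b \<otimes> b))"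
    using uv a b by (simp add: bb x_def m_assoc flip: uv(3))
  also have "(u \<otimes> u \<oplus> v \<otimes> v) \<otimes> (\<one> \<otimes> \<one> \<oplus> b \<otimes> b) =
    (u \<otimes> \<one> \<ominus> v \<otimes> b) \<otimes> (u \<otimes> \<one> \<ominus> v \<otimes> b) \<oplus> (u \<otimes> b \<oplus> v \<otimes> \<one>) \<otimes> (u \<otimes> b \<oplus> v \<otimes> \<one>)"
    by (rule two_squares_mult) (use uv b in simp_all)
  finally show ?case
    using uv b by (metis a_closed m_closed minus_closed one_closed)
qed

text \<open>
  If \<open>2^t\<close> is \<open>-1\<close> modulo the odd order of \<open>a\<close>, the telescoping product above is
  \<open>(1 - a^(-1)) / (1 - a) = - a^(-1)\<close>, where \<open>a\<close> is again a square. Hence \<open>-1\<close> is a sum of two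
  squares wherever \<open>1 - a\<close> can be cancelled.
\<close>

lemma minus_one_sum_of_two_squares:
  assumes a: "a \<in> carrier R" "a [^] (p::nat) = \<one>" and p: "odd p" and t: "p dvd 2 ^ t + 1"
  shows "\<exists>u\<in>carrier R. \<exists>v\<in>carrier R. (\<one> \<ominus> a) \<otimes> (\<one> \<oplus> u \<otimes> u \<oplus> v \<otimes> v) = \<zero>"
proof -
  obtain u v where uv: "u \<in> carrier R" "v \<in> carrier R"
    "(\<one> \<ominus> a) \<otimes> (u \<otimes> u \<oplus> v \<otimes> v) = \<one> \<ominus> a [^] ((2::nat) ^ t)"
    using one_minus_two_power_eq_sum_of_two_squares[OF a p] by blast
  define x where "x = a [^] ((2::nat) ^ t)"
  define c where "c = a [^] ((p + 1) div 2)"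
  have x: "x \<in> carrier R" and c: "c \<in> carrier R"
    using a by (simp_all add: x_def c_def)
  have half: "(p + 1) div 2 + (p + 1) div 2 = p + 1"
    using p by presburger
  then have "c \<otimes> c = a [^] (p + 1)"
    using a(1) by (simp only: c_def nat_pow_mult)
  also have "\<dots> = a"
    using a by simp
  finally have cc: "c \<otimes> c = a" .
  obtain m where "2 ^ t + 1 = p * m" using t by blast
  then have xa: "x \<otimes> a = \<one>"
    using a by (metis x_def nat_pow_Suc Suc_eq_plus1 nat_pow_pow nat_pow_one)
  have "(\<one> \<ominus> a) \<otimes> (\<one> \<oplus> (c \<otimes> u) \<otimes> (c \<otimes> u) \<oplus> (c \<otimes> v) \<otimes> (c \<otimes> v)) =
    (\<one> \<ominus> a) \<oplus> (c \<otimes> c) \<otimes> ((\<one> \<ominus> a) \<otimes> (u \<otimes> u \<oplus> v \<otimes> v))"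
    using a(1) c uv(1,2) by algebra
  also have "\<dots> = (\<one> \<ominus> a) \<oplus> a \<otimes> (\<one> \<ominus> x)"
    by (simp add: cc uv(3) x_def)
  also have "\<dots> = \<one> \<ominus> x \<otimes> a"
    using a x by algebra
  also have "\<dots> = \<zero>"
    by (simp add: xa minus_eq r_neg)
  finally show ?thesis
    using c uv by (intro bexI[of _ "c \<otimes> u"] bexI[of _ "c \<otimes> v"]) simp_all
qed

text \<open>
  This says that \<open>x^2 + x y + y^2\<close> is anisotropic over a ring that behaves like a product of
  fields with \<open>2^f\<close> elements, \<open>f\<close> odd: these contain no primitive cube root of unity, since
  \<open>2^f - 1\<close> is not divisible by 3. The equation forces \<open>x^3 = y^3\<close>, and as \<open>2^f = 3 k + 2\<close>,
  the assumption on powers recovers \<open>x\<close> and \<open>y\<close> from \<open>x^2\<close>, \<open>y^2\<close> and this common cube.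
\<close>

lemma cube_root_char_2:
  assumes xy: "x \<in> carrier R" "y \<in> carrier R"
    and char: "\<And>z. z \<in> carrier R \<Longrightarrow> z \<oplus> z = \<zero>"
    and frob: "\<And>z. z \<in> carrier R \<Longrightarrow> z [^] ((2::nat) ^ f) = z" and f: "odd f"
    and eq: "x \<otimes> x \<oplus> x \<otimes> y \<oplus> y \<otimes> y = \<zero>"
  shows "x = \<zero>"
proof -
  obtain g where f: "f = 2 * g + 1"
    using f by (rule oddE)
  have "(2::nat) ^ f mod 3 = 2"
    unfolding f
  proof (induction g)
    case (Suc g)
    have "(2::nat) ^ (2 * Suc g + 1) = 4 * 2 ^ (2 * g + 1)" by simp
    with Suc show ?case by presburger
  qed simp
  then obtain k where k: "(2::nat) ^ f = 3 * k + 2"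
    by (metis mult_div_mod_eq)
  have sq: "z [^] (2::nat) = z \<otimes> z" if "z \<in> carrier R" for z
    using that by (simp add: numeral_2_eq_2)
  have cube: "z [^] (3::nat) = z \<otimes> z \<otimes> z" if "z \<in> carrier R" for z
    using that by (simp add: numeral_3_eq_3)
  have "x \<otimes> x \<otimes> x \<ominus> y \<otimes> y \<otimes> y = (x \<ominus> y) \<otimes> (x \<otimes> x \<oplus> x \<otimes> y \<oplus> y \<otimes> y)"
    using xy by algebra
  then have xxx: "x \<otimes> x \<otimes> x = y \<otimes> y \<otimes> y"
    using xy eq by simp
  define w where "w = x [^] (3 * k)"
  have w: "w \<in> carrier R" using xy by (simp add: w_def)
  have w': "w = y [^] (3 * k)"
    using xy xxx by (simp add: w_def nat_pow_pow[symmetric] cube)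
  have x_eq: "x = w \<otimes> (x \<otimes> x)"
    using frob[OF xy(1)] xy unfolding k w_def by (simp add: sq m_assoc flip: nat_pow_mult)
  have y_eq: "y = w \<otimes> (y \<otimes> y)"
    using frob[OF xy(2)] xy unfolding k w' by (simp add: sq m_assoc flip: nat_pow_mult)
  have "x \<otimes> x = w \<otimes> (x \<otimes> x \<otimes> x)"
    using xy w by (subst (1) x_eq) (simp add: m_assoc)
  also have "\<dots> = y \<otimes> y"
    using xy w unfolding xxx by (subst (4) y_eq) (simp add: m_assoc)
  finally have xx: "x \<otimes> x = y \<otimes> y" .
  have "x \<otimes> y = (x \<otimes> x \<oplus> x \<otimes> y \<oplus> x \<otimes> x) \<ominus> (x \<otimes> x \<oplus> x \<otimes> x)"
    using xy by algebra
  also have "\<dots> = \<zero>"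
    using eq xy char[of "x \<otimes> x"] by (simp add: xx[symmetric])
  finally have "x \<otimes> y = \<zero>" .
  moreover have "x \<otimes> x \<otimes> x = (x \<otimes> y) \<otimes> y"
    using xy by (simp add: m_assoc flip: xx)
  ultimately have "x \<otimes> x \<otimes> x = \<zero>" using xy by simp
  then have "x \<otimes> x = \<zero>"
    using xy w by (subst (1) x_eq) (simp add: m_assoc)
  then show "x = \<zero>"
    using x_eq w by simp
qed

text \<open>
  The power \<open>x^(2^f)\<close> is a power of \<open>x^2\<close>.
\<close>

lemma square_zero_char_2:
  assumes x: "x \<in> carrier R"
    and frob: "x [^] ((2::nat) ^ f) = x" and f: "f \<noteq> 0"
    and eq: "x \<otimes> x = \<zero>"
  shows "x = \<zero>"
proof -
  obtain m where "f = Suc m" using f not0_implies_Suc by blast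
  then have "x = (x \<otimes> x) [^] ((2::nat) ^ m)"
    using frob x by (simp add: nat_pow_distrib nat_pow_mult mult_2)
  also have "\<dots> = \<zero>" by (simp add: eq nat_pow_zero)
  finally show ?thesis .
qed

lemma add_pow_two_power_char_2:
  assumes xy: "x \<in> carrier R" "y \<in> carrier R"
    and char: "\<And>z. z \<in> carrier R \<Longrightarrow> z \<oplus> z = \<zero>"
  shows "(x \<oplus> y) [^] ((2::nat) ^ f) = x [^] ((2::nat) ^ f) \<oplus> y [^] ((2::nat) ^ f)"
proof (induction f)
  case 0
  show ?case using xy by simp
next
  case (Suc f)
  have pow: "z [^] ((2::nat) ^ Suc f) = z [^] ((2::nat) ^ f) \<otimes> z [^] ((2::nat) ^ f)"
    if "z \<in> carrier R" for z
    using that by (simp add: nat_pow_mult mult_2)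
  have sq: "(a \<oplus> b) \<otimes> (a \<oplus> b) = a \<otimes> a \<oplus> b \<otimes> b \<oplus> (a \<otimes> b \<oplus> a \<otimes> b)"
    if "a \<in> carrier R" "b \<in> carrier R" for a b
    using that by algebra
  show ?case
    using xy by (simp add: pow[OF a_closed[OF xy]] pow[OF xy(1)] pow[OF xy(2)] Suc.IH sq char del: power_Suc)
qed

lemma three_squares_char_2:
  assumes "b \<in> carrier R" "c \<in> carrier R" "d \<in> carrier R"
    and char: "\<And>z. z \<in> carrier R \<Longrightarrow> z \<oplus> z = \<zero>"
  shows "(b \<oplus> c \<oplus> d) \<otimes> (b \<oplus> c \<oplus> d) = b \<otimes> b \<oplus> c \<otimes> c \<oplus> d \<otimes> d"
proof -
  have "(b \<oplus> c \<oplus> d) \<otimes> (b \<oplus> c \<oplus> d) = b \<otimes> b \<oplus> c \<otimes> c \<oplus> d \<otimes> d \<oplus>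
    ((b \<otimes> c \<oplus> b \<otimes> d \<oplus> c \<otimes> d) \<oplus> (b \<otimes> c \<oplus> b \<otimes> d \<oplus> c \<otimes> d))"
    using assms(1-3) by algebra
  then show ?thesis using assms(1-3) by (simp add: char)
qed

end

section \<open>Reduced rings with involution\<close>

lemma (in ring) minus_mult_minus:
  assumes "a \<in> carrier R" "b \<in> carrier R" "c \<in> carrier R" "d \<in> carrier R"
  shows "(a \<ominus> b) \<otimes> (c \<ominus> d) = (a \<otimes> c \<ominus> a \<otimes> d) \<ominus> (b \<otimes> c \<ominus> b \<otimes> d)"
  using assms by (simp add: minus_eq l_distr r_distr l_minus r_minus minus_add a_ac)

text \<open>
  The elements \<open>e r - e r e\<close> and \<open>r e - e r e\<close> have square zero.
\<close>

lemma (in ring) idempotent_central_if_reduced: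
  assumes reduced: "\<And>x. x \<in> carrier R \<Longrightarrow> x \<otimes> x = \<zero> \<Longrightarrow> x = \<zero>"
    and e: "e \<in> carrier R" "e \<otimes> e = e" and r: "r \<in> carrier R"
  shows "e \<otimes> r = r \<otimes> e"
proof -
  have ee: "e \<otimes> (e \<otimes> x) = e \<otimes> x" if "x \<in> carrier R" for x
    using e that by (simp flip: m_assoc)
  have minus_0: "x \<ominus> x = \<zero>" if "x \<in> carrier R" for x
    using that by (simp add: minus_eq r_neg)
  have "(e \<otimes> r \<ominus> e \<otimes> r \<otimes> e) \<otimes> (e \<otimes> r \<ominus> e \<otimes> r \<otimes> e) = \<zero>"
    using e r by (simp add: minus_mult_minus m_assoc ee minus_0)
  then have 1: "e \<otimes> r = e \<otimes> r \<otimes> e"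
    using e(1) r reduced[of "e \<otimes> r \<ominus> e \<otimes> r \<otimes> e"] by simp
  have "(r \<otimes> e \<ominus> e \<otimes> r \<otimes> e) \<otimes> (r \<otimes> e \<ominus> e \<otimes> r \<otimes> e) = \<zero>"
    using e r by (simp add: minus_mult_minus m_assoc ee minus_0)
  then have 2: "r \<otimes> e = e \<otimes> r \<otimes> e"
    using e(1) r reduced[of "r \<otimes> e \<ominus> e \<otimes> r \<otimes> e"] by simp
  show ?thesis using 1 2 by simp
qed

lemma (in ring) nilpotent_zero_if_reduced:
  assumes reduced: "\<And>x. x \<in> carrier R \<Longrightarrow> x \<otimes> x = \<zero> \<Longrightarrow> x = \<zero>"
    and x: "x \<in> carrier R"
  shows "x [^] (n::nat) = \<zero> \<Longrightarrow> x = \<zero>"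
proof (induction n rule: less_induct)
  case (less n)
  consider "n = 0" | "n = 1" | "n \<ge> 2" by linarith
  then show ?case
  proof cases
    case 1
    then have "\<one> = \<zero>" using less.prems by simp
    then show ?thesis using x by (metis r_one r_null)
  next
    case 2
    then show ?thesis using less.prems x by simp
  next
    case 3
    define m where "m = (n + 1) div 2"
    have m: "m < n" "m + m = n + (m + m - n)" using 3 by (auto simp: m_def)
    have "x [^] m \<otimes> x [^] m = x [^] n \<otimes> x [^] (m + m - n)"
      using x m(2) by (simp add: nat_pow_mult)
    then have "x [^] m = \<zero>"
      using x less.prems reduced[of "x [^] m"] by simp
    then show ?thesis using less.IH m(1) by blast
  qed
qed

text \<open>
  The assumption on \<open>x\<close> says \<open>x^k (1 - x g) = 0\<close>, which makes \<open>x (1 - x g)\<close> nilpotent.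
\<close>

lemma (in ring) strongly_regular_if_reduced:
  assumes reduced: "\<And>x. x \<in> carrier R \<Longrightarrow> x \<otimes> x = \<zero> \<Longrightarrow> x = \<zero>"
    and x: "x \<in> carrier R" and g: "g \<in> carrier R" "x \<otimes> g = g \<otimes> x"
    and eq: "x [^] (k::nat) = x [^] Suc k \<otimes> g"
  shows "x = x \<otimes> x \<otimes> g"
proof -
  define h where "h = \<one> \<ominus> x \<otimes> g"
  have h: "h \<in> carrier R" using x g by (simp add: h_def)
  have "x \<otimes> (x \<otimes> g) = (x \<otimes> g) \<otimes> x"
    using x g by (simp add: m_assoc flip: g(2))
  then have xh: "x \<otimes> h = h \<otimes> x"
    using x g by (simp add: h_def minus_eq l_distr r_distr l_minus r_minus)
  have "x [^] k \<otimes> h = x [^] k \<ominus> x [^] Suc k \<otimes> g"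
    using x g by (simp add: h_def minus_eq r_distr r_minus m_assoc)
  also have "\<dots> = \<zero>"
    using x unfolding eq[symmetric] by (simp add: minus_eq r_neg)
  finally have "x [^] k \<otimes> h = \<zero>" .
  moreover have "(x \<otimes> h) [^] Suc k = (x \<otimes> (x [^] k \<otimes> h)) \<otimes> h [^] k"
    unfolding pow_mult_distrib[OF xh x h]
    using x h by (simp only: nat_pow_Suc2 m_assoc m_closed nat_pow_closed)
  ultimately have "(x \<otimes> h) [^] Suc k = \<zero>"
    using x h by simp
  then have "x \<otimes> h = \<zero>"
    using x h nilpotent_zero_if_reduced[OF reduced] m_closed by blast
  moreover have "x \<otimes> h = x \<ominus> x \<otimes> x \<otimes> g"
    using x g by (simp add: h_def minus_eq r_distr r_minus m_assoc)
  ultimately show ?thesis using x g by simp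
qed

text \<open>
  In a reduced ring, an element with \<open>x = x^2 g\<close> is a unit of the corner cut out by the central
  idempotent \<open>e = x g\<close> and vanishes on the complementary corner. Subtracting the projection
  \<open>1 - e\<close> turns the zero on that corner into \<open>-1\<close>, and the difference is a unit.
\<close>

lemma (in involution_ring) star_clean_if_reduced:
  assumes reduced: "\<And>x. x \<in> carrier R \<Longrightarrow> x \<otimes> x = \<zero> \<Longrightarrow> x = \<zero>"
    and central: "\<And>e. e \<in> carrier R \<Longrightarrow> e \<otimes> e = e \<Longrightarrow>
       (\<And>x. x \<in> carrier R \<Longrightarrow> e \<otimes> x = x \<otimes> e) \<Longrightarrow> star e = e"
    and regular: "\<And>x. x \<in> carrier R \<Longrightarrow>
       \<exists>k. \<exists>g\<in>carrier R. x \<otimes> g = g \<otimes> x \<and> x [^] (k::nat) = x [^] Suc k \<otimes> g"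
  shows "star_clean R star"
  unfolding star_clean_def
proof
  fix x assume x: "x \<in> carrier R"
  then obtain k g where g: "g \<in> carrier R" "x \<otimes> g = g \<otimes> x"
    and "x [^] (k::nat) = x [^] Suc k \<otimes> g"
    using regular by blast
  then have eq: "x = x \<otimes> x \<otimes> g"
    using strongly_regular_if_reduced[of x g k] reduced x by blast
  define e where "e = x \<otimes> g"
  have e: "e \<in> carrier R" using x g by (simp add: e_def)
  have xe: "x \<otimes> e = x" using eq x g by (simp add: e_def m_assoc)
  have ee: "e \<otimes> e = e"
  proof -
    have "e \<otimes> e = (g \<otimes> x) \<otimes> e" by (simp add: e_def g(2))
    also have "\<dots> = g \<otimes> (x \<otimes> e)" using x g e by (simp add: m_assoc)
    finally show ?thesis by (simp add: xe) (simp add: e_def g(2))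
  qed
  have central_e: "e \<otimes> r = r \<otimes> e" if "r \<in> carrier R" for r
    using idempotent_central_if_reduced[OF reduced e ee that] .
  define p where "p = \<one> \<ominus> e"
  have p: "p \<in> carrier R" using e by (simp add: p_def)
  have minus_0: "y \<ominus> y = \<zero>" "y \<ominus> \<zero> = y" if "y \<in> carrier R" for y
    using that by (simp_all add: minus_eq r_neg)
  have pp: "p \<otimes> p = p"
    unfolding p_def using e by (simp add: minus_mult_minus ee minus_0)
  have "star p = p"
  proof (rule central[OF p pp])
    show "p \<otimes> r = r \<otimes> p" if "r \<in> carrier R" for r
      unfolding p_def using e that central_e[OF that]
      by (simp add: minus_eq l_distr r_distr l_minus r_minus)
  qed
  then have proj: "p \<in> projections R star"
    using p pp by (simp add: projections_def)
  define u where "u = x \<ominus> p"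
  define v where "v = e \<otimes> g \<ominus> p"
  have uv: "u \<in> carrier R" "v \<in> carrier R"
    using x p e g by (simp_all add: u_def v_def)
  have xp: "x \<otimes> p = \<zero>" unfolding p_def using x e by (simp add: r_distr minus_eq r_minus xe r_neg)
  have ep: "e \<otimes> p = \<zero>" unfolding p_def using e by (simp add: r_distr minus_eq r_minus ee r_neg)
  have px: "p \<otimes> x = \<zero>" unfolding p_def using x e central_e[OF x]
    by (simp add: l_distr minus_eq l_minus xe r_neg)
  have pe: "p \<otimes> e = \<zero>" unfolding p_def using e by (simp add: l_distr minus_eq l_minus ee r_neg)
  have egx: "g \<otimes> x = e" by (simp add: e_def g(2))
  have epg: "e \<otimes> (g \<otimes> p) = \<zero>"
  proof -
    have "e \<otimes> (g \<otimes> p) = g \<otimes> (e \<otimes> p)"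
      using e g(1) p central_e[OF g(1)] by (metis m_assoc)
    then show ?thesis using ep g(1) by simp
  qed
  have peg: "p \<otimes> (e \<otimes> g) = \<zero>" and xeg: "x \<otimes> (e \<otimes> g) = e"
    using p e x g(1) by (simp_all add: pe xe flip: m_assoc) (simp add: e_def)
  have sum: "e \<ominus> (\<zero> \<ominus> p) = \<one>"
    unfolding p_def using e by (simp add: minus_eq minus_add a_lcomm[of e] r_neg)
  have "u \<otimes> v = \<one>"
    unfolding u_def v_def using x p e g(1)
    by (simp add: minus_mult_minus xeg xp peg pp minus_0 sum)
  moreover have "v \<otimes> u = \<one>"
    unfolding u_def v_def using x p e g(1)
    by (simp add: minus_mult_minus m_assoc egx ee epg px pp minus_0 sum)
  ultimately have "u \<in> Units R"
    using uv unfolding Units_def by blast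
  moreover have "x = u \<oplus> p"
    unfolding u_def using x p by (simp add: minus_eq a_assoc l_neg)
  ultimately show "\<exists>u\<in>Units R. \<exists>p\<in>projections R star. x = u \<oplus> p"
    using proj by blast
qed

section \<open>Reducedness and finite dimension of group rings\<close>

lemma cring_group_ring:
  assumes "comm_monoid A"
  shows "cring (group_ring A :: ('a \<Rightarrow>\<^sub>0 'r::comm_ring_1) ring)"
proof -
  interpret comm_monoid A by fact
  let ?R = "group_ring A :: ('a \<Rightarrow>\<^sub>0 'r) ring"
  interpret ring ?R by (rule ring_group_ring) unfold_locales
  have comm: "x \<otimes>\<^bsub>?R\<^esub> y = y \<otimes>\<^bsub>?R\<^esub> x"
    if "Poly_Mapping.keys x \<subseteq> carrier A" and y: "Poly_Mapping.keys y \<subseteq> carrier A" for x y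
    using that(1)
  proof (induction rule: group_ring_induct)
    case (single g r)
    note g = single
    show ?case using y
      by (induction rule: group_ring_induct)
        (use g in \<open>simp_all add: m_comm mult.commute group_ring_distrib_left group_ring_distrib_right\<close>)
  qed (simp_all add: group_ring_distrib_left group_ring_distrib_right)
  show ?thesis
    by unfold_locales (use comm in auto)
qed

lemma group_ring_a_inv [simp]:
  assumes "monoid G" "Poly_Mapping.keys x \<subseteq> carrier G"
  shows "\<ominus>\<^bsub>group_ring G\<^esub> x = - x"
proof -
  interpret ring "group_ring G"
    by (rule ring_group_ring) fact
  show ?thesis
    by (rule minus_equality) (use assms in simp_all)
qed

lemma group_ring_minus [simp]:
  assumes "monoid G" "Poly_Mapping.keys x \<subseteq> carrier G" "Poly_Mapping.keys y \<subseteq> carrier G"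
  shows "x \<ominus>\<^bsub>group_ring G\<^esub> y = x - y"
  using assms by (simp add: a_minus_def)

lemma group_ring_diff_right:
  "(x - y) \<otimes>\<^bsub>group_ring G\<^esub> z = x \<otimes>\<^bsub>group_ring G\<^esub> z - y \<otimes>\<^bsub>group_ring G\<^esub> z"
  using group_ring_distrib_right[of G "x - y" y z] by (simp add: eq_diff_eq)

lemma group_ring_diff_left:
  "z \<otimes>\<^bsub>group_ring G\<^esub> (x - y) = z \<otimes>\<^bsub>group_ring G\<^esub> x - z \<otimes>\<^bsub>group_ring G\<^esub> y"
  using group_ring_distrib_left[of G z "x - y" y] by (simp add: eq_diff_eq)

lemma group_ring_mult_sum_left:
  "(\<Sum>i\<in>I. x i) \<otimes>\<^bsub>group_ring G\<^esub> y = (\<Sum>i\<in>I. x i \<otimes>\<^bsub>group_ring G\<^esub> y)"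
  by (induction I rule: infinite_finite_induct) (simp_all add: group_ring_distrib_right)

lemma group_ring_mult_sum_right:
  "y \<otimes>\<^bsub>group_ring G\<^esub> (\<Sum>i\<in>I. x i) = (\<Sum>i\<in>I. y \<otimes>\<^bsub>group_ring G\<^esub> x i)"
  by (induction I rule: infinite_finite_induct) (simp_all add: group_ring_distrib_left)

text \<open>
  The coefficient of \<open>x x^\<dagger>\<close> at the neutral element, where \<open>\<dagger>\<close> inverts group
  elements, is the sum of the squares of all coefficients of \<open>x\<close>.
\<close>

lemma mult_inverse_extension_eq_0:
  fixes x :: "'g \<Rightarrow>\<^sub>0 'r::linordered_idom"
  assumes "group G" "Poly_Mapping.keys x \<subseteq> carrier G"
    and "x \<otimes>\<^bsub>group_ring G\<^esub> linear_extension (m_inv G) x = 0"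
  shows "x = 0"
proof -
  interpret group G by fact
  let ?R = "group_ring G :: ('g \<Rightarrow>\<^sub>0 'r) ring" and ?K = "Poly_Mapping.keys x"
  have "x \<otimes>\<^bsub>?R\<^esub> linear_extension (m_inv G) x =
    (\<Sum>g\<in>?K. Poly_Mapping.single g (Poly_Mapping.lookup x g)) \<otimes>\<^bsub>?R\<^esub>
    (\<Sum>h\<in>?K. Poly_Mapping.single (inv\<^bsub>G\<^esub> h) (Poly_Mapping.lookup x h))"
    by (simp only: sum_singles linear_extension_def)
  also have "\<dots> = (\<Sum>g\<in>?K. \<Sum>h\<in>?K.
    Poly_Mapping.single (g \<otimes>\<^bsub>G\<^esub> inv\<^bsub>G\<^esub> h) (Poly_Mapping.lookup x g * Poly_Mapping.lookup x h))"
    by (simp only: group_ring_mult_sum_left) (simp add: group_ring_mult_sum_right)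
  finally have "0 = Poly_Mapping.lookup (\<Sum>g\<in>?K. \<Sum>h\<in>?K.
    Poly_Mapping.single (g \<otimes>\<^bsub>G\<^esub> inv\<^bsub>G\<^esub> h) (Poly_Mapping.lookup x g * Poly_Mapping.lookup x h)) \<one>\<^bsub>G\<^esub>"
    using assms(3) by simp
  also have "\<dots> = (\<Sum>g\<in>?K. \<Sum>h\<in>?K. if g = h then Poly_Mapping.lookup x g * Poly_Mapping.lookup x h else 0)"
    unfolding lookup_sum
  proof (intro sum.cong refl)
    fix g h assume "g \<in> ?K" "h \<in> ?K"
    then have gh: "g \<in> carrier G" "h \<in> carrier G" using assms(2) by auto
    then have "g \<otimes>\<^bsub>G\<^esub> inv\<^bsub>G\<^esub> h = \<one>\<^bsub>G\<^esub> \<longleftrightarrow> g = h"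
      by (metis inv_closed inv_equality inv_inv r_inv)
    then show "Poly_Mapping.lookup (Poly_Mapping.single (g \<otimes>\<^bsub>G\<^esub> inv\<^bsub>G\<^esub> h)
        (Poly_Mapping.lookup x g * Poly_Mapping.lookup x h)) \<one>\<^bsub>G\<^esub> =
      (if g = h then Poly_Mapping.lookup x g * Poly_Mapping.lookup x h else 0)"
      by (simp add: lookup_single when_def)
  qed
  also have "\<dots> = (\<Sum>g\<in>?K. Poly_Mapping.lookup x g * Poly_Mapping.lookup x g)"
    by (simp add: sum.delta)
  finally have "\<forall>g\<in>?K. Poly_Mapping.lookup x g * Poly_Mapping.lookup x g = 0"
    by (subst (asm) eq_commute, subst (asm) sum_nonneg_eq_0_iff) auto
  then have "Poly_Mapping.lookup x g = 0" for g
    by (cases "g \<in> ?K") (auto simp: in_keys_iff)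
  then show "x = 0"
    by (intro poly_mapping_eqI) simp
qed

text \<open>
  If \<open>x^2 = 0\<close>, then \<open>y = x x^\<dagger>\<close> satisfies \<open>y y^\<dagger> = 0\<close>, and the positivity
  above applies first to \<open>y\<close> and then to \<open>x\<close>.
\<close>

lemma comm_group_ring_reduced:
  fixes x :: "'g \<Rightarrow>\<^sub>0 'r::linordered_idom"
  assumes "comm_group A" and x: "Poly_Mapping.keys x \<subseteq> carrier A"
    and xx: "x \<otimes>\<^bsub>group_ring A\<^esub> x = 0"
  shows "x = 0"
proof -
  interpret A: comm_group A by fact
  let ?R = "group_ring A :: ('g \<Rightarrow>\<^sub>0 'r) ring"
  define star :: "('g \<Rightarrow>\<^sub>0 'r) \<Rightarrow> _" where "star = linear_extension (m_inv A)"
  interpret cring ?R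
    by (rule cring_group_ring) (rule A.comm_monoid_axioms)
  interpret involution_ring ?R star
    unfolding star_def
    by (rule involution_ring_group_ring) (simp_all add: A.inv_mult A.m_comm A.is_monoid)
  have x: "x \<in> carrier ?R" and x': "star x \<in> carrier ?R"
    using x star_closed[of x] by simp_all
  have "x \<otimes>\<^bsub>?R\<^esub> star x \<otimes>\<^bsub>?R\<^esub> star (x \<otimes>\<^bsub>?R\<^esub> star x) = (x \<otimes>\<^bsub>?R\<^esub> x) \<otimes>\<^bsub>?R\<^esub> (star x \<otimes>\<^bsub>?R\<^esub> star x)"
    unfolding star_mult[OF x x'] star_star[OF x] using x x'
    by (simp only: m_ac m_closed)
  then have "x \<otimes>\<^bsub>?R\<^esub> star x \<otimes>\<^bsub>?R\<^esub> star (x \<otimes>\<^bsub>?R\<^esub> star x) = 0"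
    by (simp add: xx)
  then have "x \<otimes>\<^bsub>?R\<^esub> star x = 0"
    using m_closed[OF x x'] A.is_group A.is_monoid unfolding star_def
    by - (rule mult_inverse_extension_eq_0[of A]; simp)
  then show "x = 0"
    using x A.is_group unfolding star_def
    by - (rule mult_inverse_extension_eq_0[of A]; simp)
qed

definition scale_coeffs :: "'r::comm_ring_1 \<Rightarrow> ('g \<Rightarrow>\<^sub>0 'r) \<Rightarrow> ('g \<Rightarrow>\<^sub>0 'r)" where
  "scale_coeffs r = Poly_Mapping.map ((*) r)"

lemma lookup_scale_coeffs: "Poly_Mapping.lookup (scale_coeffs r x) g = r * Poly_Mapping.lookup x g"
  by (simp add: scale_coeffs_def map.rep_eq when_def)

lemma scale_coeffs_single [simp]:
  "scale_coeffs r (Poly_Mapping.single g s) = Poly_Mapping.single g (r * s)"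
  by (simp add: scale_coeffs_def)

lemma scale_coeffs_add: "scale_coeffs r (x + y) = scale_coeffs r x + scale_coeffs r y"
  by (rule poly_mapping_eqI) (simp add: lookup_scale_coeffs lookup_add distrib_left)

lemma scale_coeffs_diff: "scale_coeffs r (x - y) = scale_coeffs r x - scale_coeffs r y"
  by (rule poly_mapping_eqI) (simp add: lookup_scale_coeffs lookup_minus right_diff_distrib)

lemma scale_coeffs_keys: "Poly_Mapping.keys (scale_coeffs r x) \<subseteq> Poly_Mapping.keys x"
  by (auto simp: in_keys_iff lookup_scale_coeffs)

lemma scale_coeffs_0 [simp]: "scale_coeffs r 0 = 0"
  by (rule poly_mapping_eqI) (simp add: lookup_scale_coeffs)

lemma group_ring_mult_scale_coeffs:
  "scale_coeffs r x \<otimes>\<^bsub>group_ring G\<^esub> y = scale_coeffs r (x \<otimes>\<^bsub>group_ring G\<^esub> y)" (is ?left)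
  "x \<otimes>\<^bsub>group_ring G\<^esub> scale_coeffs r y = scale_coeffs r (x \<otimes>\<^bsub>group_ring G\<^esub> y)" (is ?right)
proof -
  have single: "Poly_Mapping.single g (r * s) \<otimes>\<^bsub>group_ring G\<^esub> y =
      scale_coeffs r (Poly_Mapping.single g s \<otimes>\<^bsub>group_ring G\<^esub> y) \<and>
    Poly_Mapping.single g s \<otimes>\<^bsub>group_ring G\<^esub> scale_coeffs r y =
      scale_coeffs r (Poly_Mapping.single g s \<otimes>\<^bsub>group_ring G\<^esub> y)" for g s
    using subset_UNIV[of "Poly_Mapping.keys y"]
    by (induction rule: group_ring_induct)
      (simp_all add: scale_coeffs_add group_ring_distrib_left group_ring_distrib_right mult_ac)
  have "?left \<and> ?right"
    using subset_UNIV[of "Poly_Mapping.keys x"]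
    by (induction rule: group_ring_induct)
      (simp_all add: single scale_coeffs_add group_ring_distrib_left group_ring_distrib_right)
  then show ?left ?right by simp_all
qed

lemma vector_space_scale_coeffs:
  "vector_space (scale_coeffs :: 'r::field \<Rightarrow> ('g \<Rightarrow>\<^sub>0 'r) \<Rightarrow> _)"
  by unfold_locales
    (auto intro!: poly_mapping_eqI simp: lookup_scale_coeffs lookup_add algebra_simps)

text \<open>
  This is where the finiteness of the group enters: some power \<open>x^m\<close> lies in the span of the
  higher powers, since otherwise all the powers of \<open>x\<close> would be linearly independent.
\<close>

lemma group_algebra_power_stable:
  fixes x :: "'g \<Rightarrow>\<^sub>0 'r::field"
  assumes "monoid G" and fin: "finite (carrier G)" and x: "Poly_Mapping.keys x \<subseteq> carrier G"
  defines "R \<equiv> group_ring G"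
  shows "\<exists>k. \<exists>g\<in>carrier R. x \<otimes>\<^bsub>R\<^esub> g = g \<otimes>\<^bsub>R\<^esub> x \<and> x [^]\<^bsub>R\<^esub> (k::nat) = x [^]\<^bsub>R\<^esub> Suc k \<otimes>\<^bsub>R\<^esub> g"
proof -
  interpret ring R unfolding R_def by (rule ring_group_ring) fact
  interpret vs: vector_space "scale_coeffs :: 'r \<Rightarrow> ('g \<Rightarrow>\<^sub>0 'r) \<Rightarrow> _"
    by (rule vector_space_scale_coeffs)
  have xR: "x \<in> carrier R" using x by (simp add: R_def)
  define pw where "pw = (\<lambda>k::nat. x [^]\<^bsub>R\<^esub> k)"
  have pw: "pw k \<in> carrier R" for k using xR by (simp add: pw_def)
  have "\<exists>m. pw m \<in> vs.span (pw ` {m<..})"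
  proof (rule ccontr)
    assume "\<nexists>m. pw m \<in> vs.span (pw ` {m<..})"
    then have notin: "pw m \<notin> vs.span (pw ` {m<..})" for m by blast
    define N where "N = card (carrier G)"
    \<comment> \<open>the powers are added in the order of decreasing exponents\<close>
    have "\<not> vs.dependent (pw ` {N + 1 - d..<N + 1}) \<and> card (pw ` {N + 1 - d..<N + 1}) = d"
      if "d \<le> N + 1" for d
      using that
    proof (induction d)
      case 0
      show ?case by (simp add: vs.independent_empty)
    next
      case (Suc d)
      let ?S = "pw ` {N + 1 - d..<N + 1}"
      have eq: "pw ` {N + 1 - Suc d..<N + 1} = insert (pw (N - d)) ?S"
      proof -
        have "{N + 1 - Suc d..<N + 1} = insert (N - d) {N + 1 - d..<N + 1}"
          using Suc.prems by auto
        then show ?thesis by simp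
      qed
      have "?S \<subseteq> pw ` {N - d<..}"
        using Suc.prems by (intro image_mono) auto
      then have new: "pw (N - d) \<notin> vs.span ?S"
        using notin[of "N - d"] vs.span_mono by blast
      then have "pw (N - d) \<notin> ?S"
        using vs.span_superset by blast
      then show ?case
        using Suc new unfolding eq by (simp add: vs.independent_insert)
    qed
    from this[of "N + 1"] have ind: "\<not> vs.dependent (pw ` {..<N + 1})" "card (pw ` {..<N + 1}) = N + 1"
      by (simp_all add: atLeast0LessThan)
    let ?B = "(\<lambda>g. Poly_Mapping.single g (1::'r)) ` carrier G"
    have span: "y \<in> vs.span ?B" if "Poly_Mapping.keys y \<subseteq> carrier G" for y
      using that
    proof (induction rule: group_ring_induct)
      case (single g r)
      have "scale_coeffs r (Poly_Mapping.single g 1) \<in> vs.span ?B"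
        using single by (intro vs.span_scale vs.span_base) simp
      then show ?case by simp
    qed (auto intro: vs.span_zero vs.span_add)
    have "pw ` {..<N + 1} \<subseteq> vs.span ?B"
      using pw span by (auto simp: R_def)
    then have "card (pw ` {..<N + 1}) \<le> card ?B"
      using vs.independent_span_bound[OF _ ind(1)] fin by blast
    also have "\<dots> \<le> N" unfolding N_def by (rule card_image_le[OF fin])
    finally show False using ind(2) by simp
  qed
  then obtain m where m: "pw m \<in> vs.span (pw ` {m<..})" by blast
  define W where "W = {pw (Suc m) \<otimes>\<^bsub>R\<^esub> g |g. g \<in> carrier R \<and> x \<otimes>\<^bsub>R\<^esub> g = g \<otimes>\<^bsub>R\<^esub> x}"
  have "vs.subspace W"
  proof (rule vs.subspaceI)
    show "0 \<in> W"
      unfolding W_def R_def by (intro CollectI exI[of _ 0]) simp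
  next
    fix y z assume "y \<in> W" "z \<in> W"
    then obtain g h where "y = pw (Suc m) \<otimes>\<^bsub>R\<^esub> g" "g \<in> carrier R" "x \<otimes>\<^bsub>R\<^esub> g = g \<otimes>\<^bsub>R\<^esub> x"
      "z = pw (Suc m) \<otimes>\<^bsub>R\<^esub> h" "h \<in> carrier R" "x \<otimes>\<^bsub>R\<^esub> h = h \<otimes>\<^bsub>R\<^esub> x"
      unfolding W_def by blast
    then show "y + z \<in> W"
      unfolding W_def using a_closed[of g h]
      by (intro CollectI exI[of _ "g + h"])
        (simp add: R_def group_ring_distrib_left group_ring_distrib_right)
  next
    fix r y assume "y \<in> W"
    then obtain g where "y = pw (Suc m) \<otimes>\<^bsub>R\<^esub> g" "g \<in> carrier R" "x \<otimes>\<^bsub>R\<^esub> g = g \<otimes>\<^bsub>R\<^esub> x"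
      unfolding W_def by blast
    then show "scale_coeffs r y \<in> W"
      unfolding W_def using order.trans[OF scale_coeffs_keys]
      by (intro CollectI exI[of _ "scale_coeffs r g"])
        (simp add: R_def group_ring_mult_scale_coeffs)
  qed
  moreover have "pw ` {m<..} \<subseteq> W"
  proof
    fix y assume "y \<in> pw ` {m<..}"
    then obtain k where k: "y = pw k" "m < k" by blast
    then have "k = Suc m + (k - Suc m)" by simp
    then have "y = pw (Suc m) \<otimes>\<^bsub>R\<^esub> pw (k - Suc m)"
      using k(1) nat_pow_mult[OF xR] unfolding pw_def by metis
    moreover have "x \<otimes>\<^bsub>R\<^esub> pw i = pw i \<otimes>\<^bsub>R\<^esub> x" for i
      using xR nat_pow_comm[of x 1 i] by (simp add: pw_def)
    ultimately show "y \<in> W"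
      unfolding W_def using pw by blast
  qed
  ultimately have "vs.span (pw ` {m<..}) \<subseteq> W"
    by (intro vs.span_minimal)
  then have "pw m \<in> W"
    using m by blast
  then show ?thesis
    unfolding W_def pw_def by blast
qed

section \<open>Sums of three squares in group rings\<close>

definition of_int_coeffs :: "('g \<Rightarrow>\<^sub>0 int) \<Rightarrow> ('g \<Rightarrow>\<^sub>0 'r::comm_ring_1)" where
  "of_int_coeffs = Poly_Mapping.map of_int"

lemma lookup_of_int_coeffs [simp]:
  "Poly_Mapping.lookup (of_int_coeffs x) g = of_int (Poly_Mapping.lookup x g)"
  by (simp add: of_int_coeffs_def map.rep_eq when_def)

lemma of_int_coeffs_0 [simp]: "of_int_coeffs 0 = 0"
  by (rule poly_mapping_eqI) simp

lemma of_int_coeffs_single [simp]: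
  "of_int_coeffs (Poly_Mapping.single g r) = Poly_Mapping.single g (of_int r)"
  by (simp add: of_int_coeffs_def)

lemma of_int_coeffs_add: "of_int_coeffs (x + y) = of_int_coeffs x + of_int_coeffs y"
  by (rule poly_mapping_eqI) (simp add: lookup_add)

lemma of_int_coeffs_keys: "Poly_Mapping.keys (of_int_coeffs x) \<subseteq> Poly_Mapping.keys x"
  by (auto simp: in_keys_iff)

lemma of_int_coeffs_mult:
  "of_int_coeffs (x \<otimes>\<^bsub>group_ring G\<^esub> y) = of_int_coeffs x \<otimes>\<^bsub>group_ring G\<^esub> of_int_coeffs y"
proof -
  have single: "of_int_coeffs (Poly_Mapping.single g r \<otimes>\<^bsub>group_ring G\<^esub> y) =
    Poly_Mapping.single g (of_int r) \<otimes>\<^bsub>group_ring G\<^esub> of_int_coeffs y" for g r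
    using subset_UNIV[of "Poly_Mapping.keys y"]
    by (induction rule: group_ring_induct)
      (simp_all add: of_int_coeffs_add group_ring_distrib_left)
  show ?thesis
    using subset_UNIV[of "Poly_Mapping.keys x"]
    by (induction rule: group_ring_induct)
      (simp_all add: single of_int_coeffs_add group_ring_distrib_right)
qed

lemma of_int_bit_eq_0_iff: "(of_int n :: bit) = 0 \<longleftrightarrow> even n"
proof (cases "even n")
  case True
  then obtain k where "n = 2 * k" by blast
  then show ?thesis by simp
next
  case False
  then obtain k where "n = 2 * k + 1" by (rule oddE)
  then show ?thesis by simp
qed

lemma of_int_coeffs_bit_eq_0E:
  assumes "(of_int_coeffs x :: 'g \<Rightarrow>\<^sub>0 bit) = 0"
  obtains y where "Poly_Mapping.keys y \<subseteq> Poly_Mapping.keys x" "x = y + y"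
proof
  define y where "y = Poly_Mapping.map (\<lambda>n. n div 2) x"
  have y: "Poly_Mapping.lookup y g = Poly_Mapping.lookup x g div 2" for g
    by (simp add: y_def map.rep_eq when_def)
  show "Poly_Mapping.keys y \<subseteq> Poly_Mapping.keys x"
    by (auto simp: in_keys_iff y)
  have "even (Poly_Mapping.lookup x g)" for g
    using arg_cong[OF assms, of "\<lambda>z. Poly_Mapping.lookup z g"] by (simp add: of_int_bit_eq_0_iff)
  then show "x = y + y"
    by (intro poly_mapping_eqI) (simp add: lookup_add y flip: mult_2)
qed

lemma group_ring_single_pow:
  "Poly_Mapping.single g r [^]\<^bsub>group_ring G\<^esub> (n::nat) = Poly_Mapping.single (g [^]\<^bsub>G\<^esub> n) (r ^ n)"
  by (induction n) (simp_all add: nat_pow_def mult.commute)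

lemma double_bit_eq_0: "x + x = (0 :: 'g \<Rightarrow>\<^sub>0 bit)"
  by (rule poly_mapping_eqI) (simp only: lookup_add lookup_zero mult_2[symmetric] bit_2_eq_0 mult_zero_left)

text \<open>
  In characteristic 2 the map \<open>x \<mapsto> x^(2^f)\<close> is additive, and it fixes the group elements as
  well as the coefficients \<open>0\<close> and \<open>1\<close>.
\<close>

lemma frobenius_bit:
  fixes x :: "'a \<Rightarrow>\<^sub>0 bit"
  assumes "comm_monoid A" and pow: "\<And>g. g \<in> carrier A \<Longrightarrow> g [^]\<^bsub>A\<^esub> ((2::nat) ^ f) = g"
    and x: "Poly_Mapping.keys x \<subseteq> carrier A"
  shows "x [^]\<^bsub>group_ring A\<^esub> ((2::nat) ^ f) = x"
proof -
  let ?R = "group_ring A :: ('a \<Rightarrow>\<^sub>0 bit) ring"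
  interpret cring ?R by (rule cring_group_ring) fact
  have "x \<in> carrier ?R \<and> x [^]\<^bsub>?R\<^esub> ((2::nat) ^ f) = x"
    using x
  proof (induction rule: group_ring_induct)
    case zero
    show ?case using nat_pow_zero[of "2 ^ f"] zero_closed by simp
  next
    case (single g r)
    have "r ^ 2 ^ f = r" by (cases r) simp_all
    then show ?case using single by (simp add: group_ring_single_pow pow)
  next
    case (add x y)
    then have "x \<oplus>\<^bsub>?R\<^esub> y \<in> carrier ?R" by (intro a_closed) blast+
    moreover have "(x \<oplus>\<^bsub>?R\<^esub> y) [^]\<^bsub>?R\<^esub> ((2::nat) ^ f) =
      x [^]\<^bsub>?R\<^esub> ((2::nat) ^ f) \<oplus>\<^bsub>?R\<^esub> y [^]\<^bsub>?R\<^esub> ((2::nat) ^ f)"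
      using add by (intro add_pow_two_power_char_2) (simp_all add: double_bit_eq_0)
    ultimately show ?case using add by simp
  qed
  then show ?thesis by blast
qed

context
  fixes A :: "('a, 'm) monoid_scheme" and f :: nat
  assumes A: "comm_group A" and f: "odd f"
    and pow: "\<And>g. g \<in> carrier A \<Longrightarrow> g [^]\<^bsub>A\<^esub> ((2::nat) ^ f) = g"
begin

text \<open>
  Modulo 2 the equation reads \<open>(b + c + d)^2 = 0\<close>, which gives \<open>b + c + d = 2 e\<close>. Substituting
  \<open>d = 2 e - (b + c)\<close> and dividing by 2 leaves \<open>b^2 + b c + c^2 = 0\<close> modulo 2, and
  this form is anisotropic because \<open>f\<close> is odd. Thus \<open>b\<close>, \<open>c\<close> and \<open>d\<close> can be halved.
\<close>

lemma three_squares_descent_step: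
  fixes b c d :: "'a \<Rightarrow>\<^sub>0 int"
  assumes keys: "Poly_Mapping.keys b \<subseteq> carrier A" "Poly_Mapping.keys c \<subseteq> carrier A"
      "Poly_Mapping.keys d \<subseteq> carrier A"
    and eq: "b \<otimes>\<^bsub>group_ring A\<^esub> b + c \<otimes>\<^bsub>group_ring A\<^esub> c + d \<otimes>\<^bsub>group_ring A\<^esub> d = 0"
  obtains b' c' d' where "b = b' + b'" "c = c' + c'" "d = d' + d'"
    "Poly_Mapping.keys b' \<subseteq> carrier A" "Poly_Mapping.keys c' \<subseteq> carrier A"
    "Poly_Mapping.keys d' \<subseteq> carrier A"
    "b' \<otimes>\<^bsub>group_ring A\<^esub> b' + c' \<otimes>\<^bsub>group_ring A\<^esub> c' + d' \<otimes>\<^bsub>group_ring A\<^esub> d' = 0"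
proof -
  interpret A: comm_group A by (rule A)
  let ?Z = "group_ring A :: ('a \<Rightarrow>\<^sub>0 int) ring" and ?F = "group_ring A :: ('a \<Rightarrow>\<^sub>0 bit) ring"
  interpret Z: cring ?Z by (rule cring_group_ring) (rule A.comm_monoid_axioms)
  interpret F: cring ?F by (rule cring_group_ring) (rule A.comm_monoid_axioms)
  have bcd: "b \<in> carrier ?Z" "c \<in> carrier ?Z" "d \<in> carrier ?Z"
    using keys by simp_all
  define r :: "('a \<Rightarrow>\<^sub>0 int) \<Rightarrow> ('a \<Rightarrow>\<^sub>0 bit)" where "r = of_int_coeffs"
  have r_closed: "r x \<in> carrier ?F" if "x \<in> carrier ?Z" for x
    using that of_int_coeffs_keys[of x] unfolding r_def by auto
  have r_add: "r (x + y) = r x + r y" for x y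
    by (simp add: r_def of_int_coeffs_add)
  have r_mult: "r (x \<otimes>\<^bsub>?Z\<^esub> y) = r x \<otimes>\<^bsub>?F\<^esub> r y" for x y
    by (simp add: r_def of_int_coeffs_mult)
  have r_0: "r 0 = 0" by (simp add: r_def)
  have char: "z \<oplus>\<^bsub>?F\<^esub> z = \<zero>\<^bsub>?F\<^esub>" for z
    by (simp add: double_bit_eq_0)
  have frob: "z [^]\<^bsub>?F\<^esub> ((2::nat) ^ f) = z" if "z \<in> carrier ?F" for z
    using that by (intro frobenius_bit[OF A.comm_monoid_axioms pow]) simp_all
  have halve: "\<exists>y. y \<in> carrier ?Z \<and> x = y + y" if "r x = 0" "x \<in> carrier ?Z" for x
    using that of_int_coeffs_bit_eq_0E[of x] unfolding r_def
    by (metis group_ring_simps(1) mem_Collect_eq order_trans)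
  have double_0: "x = 0" if "x + x = 0" for x :: "'a \<Rightarrow>\<^sub>0 int"
  proof (rule poly_mapping_eqI)
    fix g
    have "Poly_Mapping.lookup (x + x) g = 0" using that by simp
    then show "Poly_Mapping.lookup x g = Poly_Mapping.lookup 0 g" by (simp add: lookup_add)
  qed

  have "r b \<otimes>\<^bsub>?F\<^esub> r b \<oplus>\<^bsub>?F\<^esub> r c \<otimes>\<^bsub>?F\<^esub> r c \<oplus>\<^bsub>?F\<^esub> r d \<otimes>\<^bsub>?F\<^esub> r d = \<zero>\<^bsub>?F\<^esub>"
    using arg_cong[OF eq, of r] by (simp add: r_add r_mult r_0)
  then have sq: "(r b \<oplus>\<^bsub>?F\<^esub> r c \<oplus>\<^bsub>?F\<^esub> r d) \<otimes>\<^bsub>?F\<^esub> (r b \<oplus>\<^bsub>?F\<^esub> r c \<oplus>\<^bsub>?F\<^esub> r d) = \<zero>\<^bsub>?F\<^esub>"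
    unfolding F.three_squares_char_2[OF r_closed[OF bcd(1)] r_closed[OF bcd(2)] r_closed[OF bcd(3)] char] .
  have sum: "r b \<oplus>\<^bsub>?F\<^esub> r c \<oplus>\<^bsub>?F\<^esub> r d \<in> carrier ?F"
    using bcd by (simp only: F.a_closed r_closed)
  have "f \<noteq> 0" using f by (cases f) auto
  then have rd: "r b \<oplus>\<^bsub>?F\<^esub> r c \<oplus>\<^bsub>?F\<^esub> r d = \<zero>\<^bsub>?F\<^esub>"
    by (rule F.square_zero_char_2[OF sum frob[OF sum] _ sq])
  then have "r (b + c + d) = 0"
    by (simp add: r_add)
  then obtain e where e: "e \<in> carrier ?Z" "b + c + d = e + e"
    using halve[of "b + c + d"] Z.a_closed[OF Z.a_closed[OF bcd(1,2)] bcd(3)] by auto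
  have d: "d = e + e - (b + c)"
    using e(2) by (simp add: algebra_simps)
  have comm: "c \<otimes>\<^bsub>?Z\<^esub> b = b \<otimes>\<^bsub>?Z\<^esub> c" "e \<otimes>\<^bsub>?Z\<^esub> d = d \<otimes>\<^bsub>?Z\<^esub> e"
    using bcd e(1) by (simp_all only: Z.m_comm)
  define h where "h = b \<otimes>\<^bsub>?Z\<^esub> b + b \<otimes>\<^bsub>?Z\<^esub> c + c \<otimes>\<^bsub>?Z\<^esub> c + d \<otimes>\<^bsub>?Z\<^esub> e - e \<otimes>\<^bsub>?Z\<^esub> (b + c)"
  have "d \<otimes>\<^bsub>?Z\<^esub> d = d \<otimes>\<^bsub>?Z\<^esub> e + d \<otimes>\<^bsub>?Z\<^esub> e - d \<otimes>\<^bsub>?Z\<^esub> (b + c)"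
    by (subst (2) d) (simp only: group_ring_diff_left group_ring_distrib_left)
  also have "d \<otimes>\<^bsub>?Z\<^esub> (b + c) = e \<otimes>\<^bsub>?Z\<^esub> (b + c) + e \<otimes>\<^bsub>?Z\<^esub> (b + c) - (b + c) \<otimes>\<^bsub>?Z\<^esub> (b + c)"
    by (subst d) (simp only: group_ring_diff_right group_ring_distrib_right[of A e e "b + c"])
  finally have "h + h = b \<otimes>\<^bsub>?Z\<^esub> b + c \<otimes>\<^bsub>?Z\<^esub> c + d \<otimes>\<^bsub>?Z\<^esub> d"
    unfolding h_def by (simp add: group_ring_distrib_left group_ring_distrib_right comm(1) algebra_simps)
  then have "h = 0"
    using eq double_0[of h] by simp
  then have "b \<otimes>\<^bsub>?Z\<^esub> b + b \<otimes>\<^bsub>?Z\<^esub> c + c \<otimes>\<^bsub>?Z\<^esub> c + e \<otimes>\<^bsub>?Z\<^esub> d = e \<otimes>\<^bsub>?Z\<^esub> (b + c)"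
    by (simp add: h_def comm(2))
  also have "\<dots> = e \<otimes>\<^bsub>?Z\<^esub> (e + e) - e \<otimes>\<^bsub>?Z\<^esub> d"
    by (simp add: e(2)[symmetric] group_ring_distrib_left)
  finally have "b \<otimes>\<^bsub>?Z\<^esub> b + b \<otimes>\<^bsub>?Z\<^esub> c + c \<otimes>\<^bsub>?Z\<^esub> c + (e \<otimes>\<^bsub>?Z\<^esub> d + e \<otimes>\<^bsub>?Z\<^esub> d) = e \<otimes>\<^bsub>?Z\<^esub> e + e \<otimes>\<^bsub>?Z\<^esub> e"
    by (simp add: group_ring_distrib_left algebra_simps)
  from arg_cong[OF this, of r]
  have form: "r b \<otimes>\<^bsub>?F\<^esub> r b \<oplus>\<^bsub>?F\<^esub> r b \<otimes>\<^bsub>?F\<^esub> r c \<oplus>\<^bsub>?F\<^esub> r c \<otimes>\<^bsub>?F\<^esub> r c = \<zero>\<^bsub>?F\<^esub>"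
    by (simp add: r_add r_mult double_bit_eq_0)
  have rb: "r b = \<zero>\<^bsub>?F\<^esub>"
    by (rule F.cube_root_char_2[OF r_closed r_closed char frob f form]) (use bcd in simp_all)
  have rc: "r c = \<zero>\<^bsub>?F\<^esub>"
    using form rb F.cube_root_char_2[OF r_closed r_closed char frob f, of c b] bcd by simp
  have "r b = 0" "r c = 0" "r d = 0"
    using rb rc rd by simp_all
  then obtain b' c' d' where halves: "b' \<in> carrier ?Z" "b = b' + b'" "c' \<in> carrier ?Z" "c = c' + c'"
    "d' \<in> carrier ?Z" "d = d' + d'"
    using halve bcd by metis
  define q where "q = b' \<otimes>\<^bsub>?Z\<^esub> b' + c' \<otimes>\<^bsub>?Z\<^esub> c' + d' \<otimes>\<^bsub>?Z\<^esub> d'"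
  have "(q + q) + (q + q) = 0"
    using eq unfolding q_def halves(2,4,6)
    by (simp add: group_ring_distrib_left group_ring_distrib_right add_ac)
  then have "q = 0"
    using double_0 by blast
  then show thesis
    using that[of b' c' d'] halves unfolding q_def by simp
qed

lemma three_squares_int_dvd:
  fixes b c d :: "'a \<Rightarrow>\<^sub>0 int"
  assumes "Poly_Mapping.keys b \<subseteq> carrier A" "Poly_Mapping.keys c \<subseteq> carrier A"
      "Poly_Mapping.keys d \<subseteq> carrier A"
    and "b \<otimes>\<^bsub>group_ring A\<^esub> b + c \<otimes>\<^bsub>group_ring A\<^esub> c + d \<otimes>\<^bsub>group_ring A\<^esub> d = 0"
  shows "2 ^ k dvd Poly_Mapping.lookup b g \<and> 2 ^ k dvd Poly_Mapping.lookup c g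
    \<and> 2 ^ k dvd Poly_Mapping.lookup d g"
  using assms
proof (induction k arbitrary: b c d)
  case 0
  show ?case by simp
next
  case (Suc k)
  obtain b' c' d' where *: "b = b' + b'" "c = c' + c'" "d = d' + d'"
    "Poly_Mapping.keys b' \<subseteq> carrier A" "Poly_Mapping.keys c' \<subseteq> carrier A"
    "Poly_Mapping.keys d' \<subseteq> carrier A"
    "b' \<otimes>\<^bsub>group_ring A\<^esub> b' + c' \<otimes>\<^bsub>group_ring A\<^esub> c' + d' \<otimes>\<^bsub>group_ring A\<^esub> d' = 0"
    using three_squares_descent_step[OF Suc.prems] .
  show ?case
    using Suc.IH[OF *(4-7)] unfolding *(1-3) by (simp add: lookup_add flip: mult_2)
qed

text \<open>
  After clearing denominators, the descent shows that every coefficient is divisible by all powers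
  of 2.
\<close>

lemma three_squares_anisotropic:
  fixes b c d :: "'a \<Rightarrow>\<^sub>0 rat"
  assumes keys: "Poly_Mapping.keys b \<subseteq> carrier A" "Poly_Mapping.keys c \<subseteq> carrier A"
      "Poly_Mapping.keys d \<subseteq> carrier A"
    and eq: "b \<otimes>\<^bsub>group_ring A\<^esub> b + c \<otimes>\<^bsub>group_ring A\<^esub> c + d \<otimes>\<^bsub>group_ring A\<^esub> d = 0"
  shows "b = 0 \<and> c = 0 \<and> d = 0"
proof -
  have denom: "\<exists>N::int. N > 0 \<and> (\<forall>r\<in>F. of_int N * r \<in> \<int>)" if "finite F" for F :: "rat set"
    using that
  proof (induction F rule: finite_induct)
    case empty
    show ?case by (intro exI[of _ 1]) simp
  next
    case (insert r F)
    then obtain N :: int where N: "N > 0" "\<forall>r\<in>F. of_int N * r \<in> \<int>" by blast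
    obtain m n :: int where mn: "n > 0" "r = of_int m / of_int n"
      by (metis quotient_of_denom_pos quotient_of_div surj_pair)
    have "of_int (N * n) * r = of_int (N * m)" using mn by simp
    then have "of_int (N * n) * r \<in> \<int>" by (metis Ints_of_int)
    moreover have "of_int (N * n) * q \<in> \<int>" if "q \<in> F" for q
    proof -
      have "of_int n * (of_int N * q) \<in> \<int>" using N(2) that by (blast intro: Ints_mult Ints_of_int)
      then show ?thesis by (simp add: mult_ac)
    qed
    ultimately show ?case using N(1) mn(1) by (intro exI[of _ "N * n"]) auto
  qed
  define F where "F = Poly_Mapping.lookup b ` Poly_Mapping.keys b \<union>
    Poly_Mapping.lookup c ` Poly_Mapping.keys c \<union> Poly_Mapping.lookup d ` Poly_Mapping.keys d"
  have "finite F" by (simp add: F_def)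
  then obtain N :: int where N: "N > 0" "\<forall>r\<in>F. of_int N * r \<in> \<int>"
    using denom by blast
  define n where "n = (of_int N :: rat)"
  define i where "i = (\<lambda>x :: 'a \<Rightarrow>\<^sub>0 rat. Poly_Mapping.map (\<lambda>r. \<lfloor>n * r\<rfloor>) x)"
  have lookup_i: "Poly_Mapping.lookup (i x) g = \<lfloor>n * Poly_Mapping.lookup x g\<rfloor>" for x g
    by (simp add: i_def map.rep_eq when_def)
  have keys_i: "Poly_Mapping.keys (i x) \<subseteq> Poly_Mapping.keys x" for x
    by (auto simp: in_keys_iff lookup_i)
  have i: "of_int_coeffs (i x) = scale_coeffs n x" if "Poly_Mapping.lookup x ` Poly_Mapping.keys x \<subseteq> F" for x
  proof (rule poly_mapping_eqI)
    fix g
    have "n * Poly_Mapping.lookup x g \<in> \<int>"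
      using that N(2) unfolding n_def by (cases "g \<in> Poly_Mapping.keys x") (auto simp: in_keys_iff image_subset_iff)
    then show "Poly_Mapping.lookup (of_int_coeffs (i x)) g = Poly_Mapping.lookup (scale_coeffs n x) g"
      by (simp add: lookup_i lookup_scale_coeffs)
  qed
  have ibcd: "of_int_coeffs (i b) = scale_coeffs n b" "of_int_coeffs (i c) = scale_coeffs n c"
    "of_int_coeffs (i d) = scale_coeffs n d"
    by (rule i; auto simp: F_def)+
  let ?e = "i b \<otimes>\<^bsub>group_ring A\<^esub> i b + i c \<otimes>\<^bsub>group_ring A\<^esub> i c + i d \<otimes>\<^bsub>group_ring A\<^esub> i d"
  have "of_int_coeffs ?e = scale_coeffs n (scale_coeffs n
      (b \<otimes>\<^bsub>group_ring A\<^esub> b + c \<otimes>\<^bsub>group_ring A\<^esub> c + d \<otimes>\<^bsub>group_ring A\<^esub> d))"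
    by (simp add: of_int_coeffs_add of_int_coeffs_mult ibcd group_ring_mult_scale_coeffs scale_coeffs_add)
  then have "of_int_coeffs ?e = (0 :: 'a \<Rightarrow>\<^sub>0 rat)"
    by (simp add: eq)
  then have "(of_int (Poly_Mapping.lookup ?e g) :: rat) = 0" for g
    by (metis lookup_of_int_coeffs lookup_zero)
  then have "?e = 0"
    by (intro poly_mapping_eqI) simp
  then have dvd: "2 ^ k dvd Poly_Mapping.lookup (i b) g \<and> 2 ^ k dvd Poly_Mapping.lookup (i c) g
    \<and> 2 ^ k dvd Poly_Mapping.lookup (i d) g" for k g
    using keys keys_i by (intro three_squares_int_dvd) (blast intro: order_trans)+
  have zero: "m = 0" if "\<And>k. 2 ^ k dvd m" for m :: int
  proof (rule ccontr)
    assume "m \<noteq> 0"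
    then have "2 ^ nat \<bar>m\<bar> \<le> \<bar>m\<bar>"
      using dvd_imp_le_int[OF _ that[of "nat \<bar>m\<bar>"]] by simp
    moreover have "int (nat \<bar>m\<bar>) < int (2 ^ nat \<bar>m\<bar>)"
      by (simp only: of_nat_less_iff less_exp)
    ultimately show False by simp
  qed
  have "Poly_Mapping.lookup (i b) g = 0 \<and> Poly_Mapping.lookup (i c) g = 0 \<and> Poly_Mapping.lookup (i d) g = 0" for g
    using zero dvd by blast
  then have "i b = 0" "i c = 0" "i d = 0"
    by (auto intro: poly_mapping_eqI)
  then have "scale_coeffs n b = 0" "scale_coeffs n c = 0" "scale_coeffs n d = 0"
    using ibcd by (metis of_int_coeffs_0)+
  moreover have "x = 0" if "scale_coeffs n x = 0" for x :: "'a \<Rightarrow>\<^sub>0 rat"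
  proof (rule poly_mapping_eqI)
    fix g
    have "Poly_Mapping.lookup (scale_coeffs n x) g = 0" using that by simp
    then show "Poly_Mapping.lookup x g = Poly_Mapping.lookup 0 g"
      using N(1) by (simp add: lookup_scale_coeffs n_def)
  qed
  ultimately show ?thesis by blast
qed

end

section \<open>Characters and quaternion coordinates\<close>

text \<open>
  The linear map sending \<open>(q, a)\<close> to \<open>\<phi> q\<close> times \<open>a\<close>. If \<open>\<phi>\<close> is a character of \<open>Q\<^sub>8\<close>,
  it is a ring homomorphism onto the group ring of the second factor; the four coordinate functions
  of \<open>Q\<^sub>8\<close> as quaternions together give the homomorphism to the quaternions over that ring.
\<close>

definition fibre_sum :: "(quat \<Rightarrow> 'r) \<Rightarrow> (quat \<times> 'a \<Rightarrow>\<^sub>0 'r) \<Rightarrow> ('a \<Rightarrow>\<^sub>0 'r::comm_ring_1)" where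
  "fibre_sum \<phi> x = (\<Sum>g\<in>Poly_Mapping.keys x. Poly_Mapping.single (snd g) (\<phi> (fst g) * Poly_Mapping.lookup x g))"

lemma fibre_sum_superset:
  assumes "finite S" "Poly_Mapping.keys x \<subseteq> S"
  shows "fibre_sum \<phi> x = (\<Sum>g\<in>S. Poly_Mapping.single (snd g) (\<phi> (fst g) * Poly_Mapping.lookup x g))"
  unfolding fibre_sum_def
  by (rule sum.mono_neutral_left) (use assms in \<open>auto simp: in_keys_iff\<close>)

lemma fibre_sum_add: "fibre_sum \<phi> (x + y) = fibre_sum \<phi> x + fibre_sum \<phi> y"
  using Poly_Mapping.keys_add[of x y]
  by (simp add: fibre_sum_superset[of "Poly_Mapping.keys x \<union> Poly_Mapping.keys y"] lookup_add
      single_add distrib_left sum.distrib)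

lemma fibre_sum_0 [simp]: "fibre_sum \<phi> 0 = 0"
  by (simp add: fibre_sum_def)

lemma fibre_sum_single [simp]:
  "fibre_sum \<phi> (Poly_Mapping.single g r) = Poly_Mapping.single (snd g) (\<phi> (fst g) * r)"
  by (simp add: fibre_sum_def)

lemma fibre_sum_diff: "fibre_sum \<phi> (x - y) = fibre_sum \<phi> x - fibre_sum \<phi> y"
  using fibre_sum_add[of \<phi> "x - y" y] by (simp add: eq_diff_eq)

lemma fibre_sum_keys:
  assumes "Poly_Mapping.keys x \<subseteq> carrier (Q8 \<times>\<times> A)"
  shows "Poly_Mapping.keys (fibre_sum \<phi> x) \<subseteq> carrier A"
  unfolding fibre_sum_def
  by (rule order.trans[OF Poly_Mapping.keys_sum]) (use assms in \<open>auto split: if_splits\<close>)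

lemma lookup_fibre_sum:
  assumes "Poly_Mapping.keys x \<subseteq> carrier (Q8 \<times>\<times> A)"
  shows "Poly_Mapping.lookup (fibre_sum \<phi> x) a = (\<Sum>q\<in>carrier Q8. \<phi> q * Poly_Mapping.lookup x (q, a))"
  using assms
proof (induction rule: group_ring_induct)
  case (single g r)
  obtain q b where g: "g = (q, b)" by (cases g)
  have fin: "finite (carrier Q8)" by (simp add: Q8_def)
  have "(\<Sum>q'\<in>carrier Q8. \<phi> q' * Poly_Mapping.lookup (Poly_Mapping.single g r) (q', a)) =
    (\<Sum>q'\<in>carrier Q8. if q = q' then \<phi> q * r * (if b = a then 1 else 0) else 0)"
    by (intro sum.cong) (auto simp: lookup_single g when_def)
  also have "\<dots> = \<phi> q * r * (if b = a then 1 else 0)"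
    using single fin by (simp add: g)
  finally show ?case by (simp add: g lookup_single when_def)
qed (simp_all add: fibre_sum_add lookup_add distrib_left sum.distrib)

definition coord :: "nat \<Rightarrow> quat \<Rightarrow> 'r::ring_1" where
  "coord n = (\<lambda>(a, b, c, d). of_int ([a, b, c, d] ! n))"

text \<open>
  The four characters of \<open>Q\<^sub>8\<close> with values \<open>\<plusminus>1\<close>: the trivial one and those whose kernel
  is generated by \<open>i\<close>, \<open>j\<close> and \<open>k\<close>, respectively.
\<close>

definition sgn_char :: "nat \<Rightarrow> quat \<Rightarrow> 'r::ring_1" where
  "sgn_char n = (\<lambda>(a, b, c, d). of_int ([1, 1 - 2 * (c * c + d * d), 1 - 2 * (b * b + d * d), 1 - 2 * (b * b + c * c)] ! n))"

lemma all_less_4: "(\<forall>n<4. P n) \<longleftrightarrow> P 0 \<and> P 1 \<and> P 2 \<and> P (3::nat)"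
  by (auto simp: numeral_eq_Suc less_Suc_eq)

text \<open>
  On each fibre over \<open>a\<close> these are eight linear forms in the eight coefficients, and they are linearly
  independent: the characters see the sums over \<open>q\<close> and \<open>-q\<close>, the coordinates the differences.
\<close>

lemma fibre_sums_jointly_injective:
  fixes x :: "quat \<times> 'a \<Rightarrow>\<^sub>0 'r::linordered_field"
  assumes x: "Poly_Mapping.keys x \<subseteq> carrier (Q8 \<times>\<times> A)"
    and coord: "\<forall>n<4. fibre_sum (coord n) x = 0"
    and char: "\<forall>n<4. fibre_sum (sgn_char n) x = 0"
  shows "x = 0"
proof (rule poly_mapping_eqI)
  fix g :: "quat \<times> 'a"
  obtain q a where g: "g = (q, a)" by (cases g)
  define v where "v = (\<lambda>q. Poly_Mapping.lookup x (q, a))"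
  have eqs: "\<forall>n<4. (\<Sum>q\<in>carrier Q8. coord n q * v q) = 0"
    "\<forall>n<4. (\<Sum>q\<in>carrier Q8. sgn_char n q * v q) = 0"
    using coord char unfolding v_def lookup_fibre_sum[OF x, symmetric] by simp_all
  have "\<forall>q\<in>carrier Q8. v q = 0"
    using eqs unfolding all_less_4
    by (simp add: Q8_def coord_def sgn_char_def)
  moreover have "v q = 0" if "q \<notin> carrier Q8" for q
  proof -
    have "(q, a) \<notin> Poly_Mapping.keys x"
      using that x by auto
    then show ?thesis by (simp add: v_def in_keys_iff)
  qed
  ultimately have "v q = 0"
    by (cases "q \<in> carrier Q8") blast+
  then show "Poly_Mapping.lookup x g = Poly_Mapping.lookup 0 g"
    by (simp add: g v_def)
qed

lemma fibre_sum_hom: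
  assumes hom: "\<And>q q'. q \<in> carrier Q8 \<Longrightarrow> q' \<in> carrier Q8 \<Longrightarrow> \<phi> (quat_mult q q') = \<phi> q * \<phi> q'"
    and x: "Poly_Mapping.keys x \<subseteq> carrier (Q8 \<times>\<times> A)" and y: "Poly_Mapping.keys y \<subseteq> carrier (Q8 \<times>\<times> A)"
  shows "fibre_sum \<phi> (x \<otimes>\<^bsub>group_ring (Q8 \<times>\<times> A)\<^esub> y) = fibre_sum \<phi> x \<otimes>\<^bsub>group_ring A\<^esub> fibre_sum \<phi> y"
  using x
proof (induction rule: group_ring_induct)
  case (single g r)
  note g = single
  show ?case using y
  proof (induction rule: group_ring_induct)
    case (single h s)
    have "fst (g \<otimes>\<^bsub>Q8 \<times>\<times> A\<^esub> h) = quat_mult (fst g) (fst h)" "snd (g \<otimes>\<^bsub>Q8 \<times>\<times> A\<^esub> h) = snd g \<otimes>\<^bsub>A\<^esub> snd h"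
      by (simp_all add: DirProd_def Q8_def split: prod.splits)
    moreover have "fst g \<in> carrier Q8" "fst h \<in> carrier Q8"
      using single g by auto
    ultimately show ?case by (simp add: hom mult_ac)
  qed (simp_all add: group_ring_distrib_left fibre_sum_add)
qed (simp_all add: group_ring_distrib_right fibre_sum_add)

lemma fibre_sum_coord_mult:
  fixes x y :: "quat \<times> 'a \<Rightarrow>\<^sub>0 'r::comm_ring_1"
  shows
  "fibre_sum (coord 0) (x \<otimes>\<^bsub>group_ring (Q8 \<times>\<times> A)\<^esub> y) =
     fibre_sum (coord 0) x \<otimes>\<^bsub>group_ring A\<^esub> fibre_sum (coord 0) y
     - fibre_sum (coord 1) x \<otimes>\<^bsub>group_ring A\<^esub> fibre_sum (coord 1) y
     - fibre_sum (coord 2) x \<otimes>\<^bsub>group_ring A\<^esub> fibre_sum (coord 2) y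
     - fibre_sum (coord 3) x \<otimes>\<^bsub>group_ring A\<^esub> fibre_sum (coord 3) y" (is "?p0 x y")
  "fibre_sum (coord 1) (x \<otimes>\<^bsub>group_ring (Q8 \<times>\<times> A)\<^esub> y) =
     fibre_sum (coord 0) x \<otimes>\<^bsub>group_ring A\<^esub> fibre_sum (coord 1) y
     + fibre_sum (coord 1) x \<otimes>\<^bsub>group_ring A\<^esub> fibre_sum (coord 0) y
     + fibre_sum (coord 2) x \<otimes>\<^bsub>group_ring A\<^esub> fibre_sum (coord 3) y
     - fibre_sum (coord 3) x \<otimes>\<^bsub>group_ring A\<^esub> fibre_sum (coord 2) y" (is "?p1 x y")
  "fibre_sum (coord 2) (x \<otimes>\<^bsub>group_ring (Q8 \<times>\<times> A)\<^esub> y) =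
     fibre_sum (coord 0) x \<otimes>\<^bsub>group_ring A\<^esub> fibre_sum (coord 2) y
     - fibre_sum (coord 1) x \<otimes>\<^bsub>group_ring A\<^esub> fibre_sum (coord 3) y
     + fibre_sum (coord 2) x \<otimes>\<^bsub>group_ring A\<^esub> fibre_sum (coord 0) y
     + fibre_sum (coord 3) x \<otimes>\<^bsub>group_ring A\<^esub> fibre_sum (coord 1) y" (is "?p2 x y")
  "fibre_sum (coord 3) (x \<otimes>\<^bsub>group_ring (Q8 \<times>\<times> A)\<^esub> y) =
     fibre_sum (coord 0) x \<otimes>\<^bsub>group_ring A\<^esub> fibre_sum (coord 3) y
     + fibre_sum (coord 1) x \<otimes>\<^bsub>group_ring A\<^esub> fibre_sum (coord 2) y
     - fibre_sum (coord 2) x \<otimes>\<^bsub>group_ring A\<^esub> fibre_sum (coord 1) y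
     + fibre_sum (coord 3) x \<otimes>\<^bsub>group_ring A\<^esub> fibre_sum (coord 0) y" (is "?p3 x y")
proof -
  let ?P = "\<lambda>x y. ?p0 x y \<and> ?p1 x y \<and> ?p2 x y \<and> ?p3 x y"
  have base: "?P (Poly_Mapping.single g r) y" for g r
    using subset_UNIV[of "Poly_Mapping.keys y"]
  proof (induction rule: group_ring_induct)
    case (single h s)
    obtain a b c d u where g: "g = ((a, b, c, d), u)" by (metis surj_pair)
    obtain a' b' c' d' v where h: "h = ((a', b', c', d'), v)" by (metis surj_pair)
    show ?case
      by (simp add: g h Q8_def coord_def single_add[symmetric] single_diff[symmetric] numeral_eq_Suc del: single_add)
        (simp add: algebra_simps)
  next
    case (add y z)
    then show ?case
      by (simp add: fibre_sum_add group_ring_distrib_left)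
  qed simp
  have "?P x y"
    using subset_UNIV[of "Poly_Mapping.keys x"]
  proof (induction rule: group_ring_induct)
    case (single g r)
    show ?case by (rule base)
  next
    case (add x z)
    then show ?case
      by (simp add: fibre_sum_add group_ring_distrib_right)
  qed simp
  then show "?p0 x y" "?p1 x y" "?p2 x y" "?p3 x y" by blast+
qed

lemma uminus_eq_self_poly_mapping: "x = - x \<Longrightarrow> x = 0" for x :: "'g \<Rightarrow>\<^sub>0 'r::linordered_idom"
proof (rule poly_mapping_eqI)
  fix g assume "x = - x"
  then have "Poly_Mapping.lookup x g = - Poly_Mapping.lookup x g"
    by (metis lookup_uminus)
  then show "Poly_Mapping.lookup x g = Poly_Mapping.lookup 0 g" by simp
qed

lemma coord_simps:
  "coord 0 (a, b, c, d) = of_int a" "coord 1 (a, b, c, d) = of_int b" "coord (Suc 0) (a, b, c, d) = of_int b"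
  "coord 2 (a, b, c, d) = of_int c" "coord 3 (a, b, c, d) = of_int d"
  by (simp_all add: coord_def numeral_eq_Suc)

lemma sgn_char_mult:
  assumes "n < 4" "q \<in> carrier Q8" "q' \<in> carrier Q8"
  shows "sgn_char n (quat_mult q q') = (sgn_char n q * sgn_char n q' :: 'r::comm_ring_1)"
proof -
  have "\<forall>n<4. \<forall>q\<in>carrier Q8. \<forall>q'\<in>carrier Q8. sgn_char n (quat_mult q q') = (sgn_char n q * sgn_char n q' :: 'r)"
    unfolding all_less_4 by (simp add: Q8_def sgn_char_def numeral_eq_Suc)
  then show ?thesis using assms by blast
qed

lemma fibre_sum_linear_extension_Pair:
  "fibre_sum \<phi> (linear_extension (Pair q) y) = scale_coeffs (\<phi> q) y"
  using subset_UNIV[of "Poly_Mapping.keys y"]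
  by (induction rule: group_ring_induct)
    (simp_all add: linear_extension_add fibre_sum_add scale_coeffs_add)

section \<open>The group ring of a product with the quaternion group\<close>

context
  fixes A :: "('a, 'm) monoid_scheme" and star :: "(quat \<times> 'a \<Rightarrow>\<^sub>0 rat) \<Rightarrow> (quat \<times> 'a \<Rightarrow>\<^sub>0 rat)"
  assumes A: "comm_group A"
  defines "star \<equiv> linear_extension (canonical_involution (Q8 \<times>\<times> A))"
begin

interpretation A: comm_group A by (rule A)

private abbreviation (input) R where "R \<equiv> group_ring (Q8 \<times>\<times> A) :: (quat \<times> 'a \<Rightarrow>\<^sub>0 rat) ring"
private abbreviation (input) QA where "QA \<equiv> group_ring A :: ('a \<Rightarrow>\<^sub>0 rat) ring"

interpretation R: involution_ring R star
  unfolding star_def by (rule involution_ring_Q8_times) (rule A)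

interpretation QA: cring QA
  by (rule cring_group_ring) (rule A.comm_monoid_axioms)

lemma fibre_sum_star_even:
  assumes x: "Poly_Mapping.keys x \<subseteq> carrier (Q8 \<times>\<times> A)"
    and "\<And>a b c d. \<phi> (a, - b, - c, - d) = \<phi> (a, b, c, d)"
  shows "fibre_sum \<phi> (star x) = fibre_sum \<phi> x"
  using x
proof (induction rule: group_ring_induct)
  case (single g r)
  obtain a b c d u where g: "g = ((a, b, c, d), u)" by (metis surj_pair)
  show ?case
    using canonical_involution_Q8_times[OF A single[unfolded g]] assms(2) by (simp add: star_def g)
qed (simp_all add: star_def linear_extension_add fibre_sum_add)

lemma fibre_sum_star_odd:
  assumes x: "Poly_Mapping.keys x \<subseteq> carrier (Q8 \<times>\<times> A)"
    and "\<And>a b c d. \<phi> (a, - b, - c, - d) = - \<phi> (a, b, c, d)"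
  shows "fibre_sum \<phi> (star x) = - fibre_sum \<phi> x"
  using x
proof (induction rule: group_ring_induct)
  case (single g r)
  obtain a b c d u where g: "g = ((a, b, c, d), u)" by (metis surj_pair)
  show ?case
    using canonical_involution_Q8_times[OF A single[unfolded g]] assms(2)
    by (simp add: star_def g single_uminus)
qed (simp_all add: star_def linear_extension_add fibre_sum_add)

lemma coord_star:
  assumes "Poly_Mapping.keys x \<subseteq> carrier (Q8 \<times>\<times> A)"
  shows "fibre_sum (coord 0) (star x) = fibre_sum (coord 0) x"
    "fibre_sum (coord 1) (star x) = - fibre_sum (coord 1) x"
    "fibre_sum (coord 2) (star x) = - fibre_sum (coord 2) x"
    "fibre_sum (coord 3) (star x) = - fibre_sum (coord 3) x"
  by (rule fibre_sum_star_even[OF assms] fibre_sum_star_odd[OF assms]; simp add: coord_simps)+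

lemma self_adjoint_coord:
  assumes "Poly_Mapping.keys x \<subseteq> carrier (Q8 \<times>\<times> A)" "star x = x"
  shows "fibre_sum (coord 1) x = 0" "fibre_sum (coord 2) x = 0" "fibre_sum (coord 3) x = 0"
  using coord_star[OF assms(1)] unfolding assms(2) by (auto intro: uminus_eq_self_poly_mapping)

text \<open>
  The involution only changes the sign of the imaginary quaternion coordinates, and these vanish
  for an element commuting with \<open>i\<close> and \<open>j\<close>.
\<close>

lemma central_imp_self_adjoint:
  assumes e: "e \<in> carrier R" and central: "\<And>x. x \<in> carrier R \<Longrightarrow> e \<otimes>\<^bsub>R\<^esub> x = x \<otimes>\<^bsub>R\<^esub> e"
  shows "star e = e"
proof -
  have keys: "Poly_Mapping.keys e \<subseteq> carrier (Q8 \<times>\<times> A)" using e by simp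
  have fs: "fibre_sum (coord n) e \<in> carrier QA" for n
    using fibre_sum_keys[OF keys] by simp
  let ?i = "Poly_Mapping.single ((0, 1, 0, 0), \<one>\<^bsub>A\<^esub>) 1 :: quat \<times> 'a \<Rightarrow>\<^sub>0 rat"
    and ?j = "Poly_Mapping.single ((0, 0, 1, 0), \<one>\<^bsub>A\<^esub>) 1 :: quat \<times> 'a \<Rightarrow>\<^sub>0 rat"
  have i: "?i \<in> carrier R" and j: "?j \<in> carrier R"
    by (simp_all add: Q8_def)
  have one: "Poly_Mapping.single \<one>\<^bsub>A\<^esub> 1 = \<one>\<^bsub>QA\<^esub>" by simp
  have 1: "fibre_sum (coord 1) e = 0"
    using arg_cong[OF central[OF j], of "fibre_sum (coord 3)"] QA.l_one[OF fs] QA.r_one[OF fs]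
    by (simp add: fibre_sum_coord_mult coord_simps) (auto intro: uminus_eq_self_poly_mapping)
  have 2: "fibre_sum (coord 2) e = 0"
    using arg_cong[OF central[OF i], of "fibre_sum (coord 3)"] QA.l_one[OF fs] QA.r_one[OF fs]
    by (simp add: fibre_sum_coord_mult coord_simps) (auto intro: uminus_eq_self_poly_mapping)
  have 3: "fibre_sum (coord 3) e = 0"
    using arg_cong[OF central[OF i], of "fibre_sum (coord 2)"] QA.l_one[OF fs] QA.r_one[OF fs]
    by (simp add: fibre_sum_coord_mult coord_simps) (auto intro: uminus_eq_self_poly_mapping)
  have "star e - e = 0"
  proof (rule fibre_sums_jointly_injective)
    have "star e - e = star e \<ominus>\<^bsub>R\<^esub> e"
      using R.star_closed[OF e] keys by (subst group_ring_minus) (simp_all add: DirProd_monoid group.is_monoid[OF group_Q8] A.is_monoid)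
    then show "Poly_Mapping.keys (star e - e) \<subseteq> carrier (Q8 \<times>\<times> A)"
      using R.minus_closed[OF R.star_closed[OF e] e] by simp
    show "\<forall>n<4. fibre_sum (coord n) (star e - e) = 0"
      unfolding all_less_4 fibre_sum_diff coord_star[OF keys] 1 2 3 by simp
    show "\<forall>n<4. fibre_sum (sgn_char n) (star e - e) = 0"
      unfolding all_less_4 fibre_sum_diff
      by (intro conjI; subst fibre_sum_star_even[OF keys]; simp add: sgn_char_def numeral_eq_Suc)
  qed
  then show ?thesis by simp
qed

text \<open>
  Let \<open>x^2 = 0\<close>. The characters kill \<open>x\<close>, since the group ring of \<open>A\<close> is reduced. For the quaternion
  \<open>a + b i + c j + d k\<close> given by the coordinates, the imaginary part of its square yields
  \<open>a b = a c = a d = 0\<close> and the real part \<open>a^2 = b^2 + c^2 + d^2\<close>. Hence \<open>a^3 = 0\<close>, so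
  \<open>a = 0\<close>, and \<open>x\<close> is a pure quaternion of norm zero.
\<close>

lemma reduced_Q8_times:
  assumes three_squares: "\<And>b c d. b \<in> carrier QA \<Longrightarrow> c \<in> carrier QA \<Longrightarrow> d \<in> carrier QA \<Longrightarrow>
      b \<otimes>\<^bsub>QA\<^esub> b + c \<otimes>\<^bsub>QA\<^esub> c + d \<otimes>\<^bsub>QA\<^esub> d = 0 \<Longrightarrow> b = 0 \<and> c = 0 \<and> d = 0"
    and x: "x \<in> carrier R" and xx: "x \<otimes>\<^bsub>R\<^esub> x = 0"
  shows "x = 0"
proof (rule fibre_sums_jointly_injective)
  show keys: "Poly_Mapping.keys x \<subseteq> carrier (Q8 \<times>\<times> A)" using x by simp
  have reduced: "y = 0" if "y \<in> carrier QA" "y \<otimes>\<^bsub>QA\<^esub> y = 0" for y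
    using that by - (rule comm_group_ring_reduced[OF A]; simp)
  have closed: "fibre_sum \<phi> x \<in> carrier QA" for \<phi>
    using fibre_sum_keys[OF keys] by simp
  show "\<forall>n<4. fibre_sum (sgn_char n) x = 0"
  proof (intro allI impI, rule reduced[OF closed])
    fix n :: nat assume "n < 4"
    then show "fibre_sum (sgn_char n) x \<otimes>\<^bsub>QA\<^esub> fibre_sum (sgn_char n) x = 0"
      using fibre_sum_hom[of "sgn_char n", OF sgn_char_mult keys keys] xx by simp
  qed
  define a b c d where "a = fibre_sum (coord 0) x" and "b = fibre_sum (coord 1) x"
    and "c = fibre_sum (coord 2) x" and "d = fibre_sum (coord 3) x"
  have abcd: "a \<in> carrier QA" "b \<in> carrier QA" "c \<in> carrier QA" "d \<in> carrier QA"
    unfolding a_def b_def c_def d_def by (rule closed)+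
  note mult = fibre_sum_coord_mult[where x = x and y = x and A = A, unfolded xx fibre_sum_0,
      folded a_def b_def c_def d_def]
  have double_0: "y = 0" if "y + y = 0" for y :: "'a \<Rightarrow>\<^sub>0 rat"
    using that by (intro uminus_eq_self_poly_mapping) (simp add: eq_neg_iff_add_eq_0)
  have comm: "y \<otimes>\<^bsub>QA\<^esub> z = z \<otimes>\<^bsub>QA\<^esub> y" if "y \<in> carrier QA" "z \<in> carrier QA" for y z
    using that by (rule QA.m_comm)
  have "a \<otimes>\<^bsub>QA\<^esub> b + a \<otimes>\<^bsub>QA\<^esub> b = 0" "a \<otimes>\<^bsub>QA\<^esub> c + a \<otimes>\<^bsub>QA\<^esub> c = 0" "a \<otimes>\<^bsub>QA\<^esub> d + a \<otimes>\<^bsub>QA\<^esub> d = 0"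
    using mult(2-4) comm[OF abcd(1,2)] comm[OF abcd(1,3)] comm[OF abcd(1,4)]
      comm[OF abcd(2,3)] comm[OF abcd(2,4)] comm[OF abcd(3,4)]
    by simp_all
  from this[THEN double_0]
  have "a \<otimes>\<^bsub>QA\<^esub> (b \<otimes>\<^bsub>QA\<^esub> b) = 0" "a \<otimes>\<^bsub>QA\<^esub> (c \<otimes>\<^bsub>QA\<^esub> c) = 0" "a \<otimes>\<^bsub>QA\<^esub> (d \<otimes>\<^bsub>QA\<^esub> d) = 0"
    using abcd by (simp_all flip: QA.m_assoc del: group_ring_simps(1))
  moreover have "a \<otimes>\<^bsub>QA\<^esub> (a \<otimes>\<^bsub>QA\<^esub> a - b \<otimes>\<^bsub>QA\<^esub> b - c \<otimes>\<^bsub>QA\<^esub> c - d \<otimes>\<^bsub>QA\<^esub> d) = 0"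
    by (simp flip: mult(1))
  ultimately have aaa: "a \<otimes>\<^bsub>QA\<^esub> (a \<otimes>\<^bsub>QA\<^esub> a) = 0"
    by (simp add: group_ring_diff_left)
  have aa: "a \<otimes>\<^bsub>QA\<^esub> a \<in> carrier QA" using abcd(1) by (rule QA.m_closed[OF abcd(1)])
  have "(a \<otimes>\<^bsub>QA\<^esub> a) \<otimes>\<^bsub>QA\<^esub> (a \<otimes>\<^bsub>QA\<^esub> a) = 0"
    using abcd(1) aa by (simp add: QA.m_assoc aaa del: group_ring_simps(1))
  then have a: "a = 0" using reduced aa abcd(1) by blast
  then have "b \<otimes>\<^bsub>QA\<^esub> b + c \<otimes>\<^bsub>QA\<^esub> c + d \<otimes>\<^bsub>QA\<^esub> d = 0"
    using mult(1) by (simp add: algebra_simps)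
  then show "\<forall>n<4. fibre_sum (coord n) x = 0"
    using three_squares[OF abcd(2-4)] a unfolding all_less_4 a_def b_def c_def d_def by blast
qed

lemma star_clean_Q8_times:
  assumes fin: "finite (carrier A)" and f: "odd f"
    and pow: "\<And>g. g \<in> carrier A \<Longrightarrow> g [^]\<^bsub>A\<^esub> ((2::nat) ^ f) = g"
  shows "star_clean R star"
proof (rule R.star_clean_if_reduced)
  fix x assume "x \<in> carrier R" "x \<otimes>\<^bsub>R\<^esub> x = \<zero>\<^bsub>R\<^esub>"
  moreover have "b = 0 \<and> c = 0 \<and> d = 0" if "b \<in> carrier QA" "c \<in> carrier QA" "d \<in> carrier QA"
    "b \<otimes>\<^bsub>QA\<^esub> b + c \<otimes>\<^bsub>QA\<^esub> c + d \<otimes>\<^bsub>QA\<^esub> d = 0" for b c d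
    using that by (intro three_squares_anisotropic[OF A f pow]) simp_all
  ultimately show "x = \<zero>\<^bsub>R\<^esub>"
    using reduced_Q8_times[of x] by simp
next
  fix e assume "e \<in> carrier R" "\<And>x. x \<in> carrier R \<Longrightarrow> e \<otimes>\<^bsub>R\<^esub> x = x \<otimes>\<^bsub>R\<^esub> e"
  then show "star e = e" by (rule central_imp_self_adjoint)
next
  fix x assume "x \<in> carrier R"
  moreover have "finite (carrier (Q8 \<times>\<times> A))"
    using fin by (simp add: Q8_def)
  ultimately show "\<exists>k. \<exists>g\<in>carrier R. x \<otimes>\<^bsub>R\<^esub> g = g \<otimes>\<^bsub>R\<^esub> x \<and> x [^]\<^bsub>R\<^esub> (k::nat) = x [^]\<^bsub>R\<^esub> Suc k \<otimes>\<^bsub>R\<^esub> g"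
    by (intro group_algebra_power_stable DirProd_monoid group.is_monoid[OF group_Q8] A.is_monoid) simp_all
qed

definition quat_norm :: "(quat \<times> 'a \<Rightarrow>\<^sub>0 rat) \<Rightarrow> ('a \<Rightarrow>\<^sub>0 rat)" where
  "quat_norm x = fibre_sum (coord 0) (x \<otimes>\<^bsub>R\<^esub> star x)"

lemma quat_norm_eq:
  assumes "x \<in> carrier R"
  shows "quat_norm x = fibre_sum (coord 0) x \<otimes>\<^bsub>QA\<^esub> fibre_sum (coord 0) x
    + fibre_sum (coord 1) x \<otimes>\<^bsub>QA\<^esub> fibre_sum (coord 1) x
    + fibre_sum (coord 2) x \<otimes>\<^bsub>QA\<^esub> fibre_sum (coord 2) x
    + fibre_sum (coord 3) x \<otimes>\<^bsub>QA\<^esub> fibre_sum (coord 3) x"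
proof -
  have uminus: "y \<otimes>\<^bsub>QA\<^esub> (- z) = - (y \<otimes>\<^bsub>QA\<^esub> z)" for y z
    using group_ring_diff_left[of A y 0 z] by simp
  show ?thesis
    using assms coord_star[of x] by (simp add: quat_norm_def fibre_sum_coord_mult uminus)
qed

text \<open>
  The norm is multiplicative: if \<open>v\<close> is the inverse of \<open>w\<close>, then
  \<open>(w w^*) (v^* v) = 1\<close>, where \<open>w w^*\<close> has no imaginary coordinates.
\<close>

lemma quat_norm_unit:
  assumes w: "w \<in> Units R"
  shows "\<exists>y\<in>carrier QA. quat_norm w \<otimes>\<^bsub>QA\<^esub> y = \<one>\<^bsub>QA\<^esub>"
proof -
  obtain v where wv: "w \<in> carrier R" "v \<in> carrier R" "w \<otimes>\<^bsub>R\<^esub> v = \<one>\<^bsub>R\<^esub>" "v \<otimes>\<^bsub>R\<^esub> w = \<one>\<^bsub>R\<^esub>"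
    using w unfolding Units_def by blast
  have s: "star w \<in> carrier R" "star v \<in> carrier R"
    using wv R.star_closed by blast+
  have star_one: "star \<one>\<^bsub>R\<^esub> = \<one>\<^bsub>R\<^esub>"
    using R.star_mult[OF R.star_closed[OF R.one_closed] R.one_closed] R.star_star[OF R.one_closed]
      R.r_one[OF R.star_closed[OF R.one_closed]] by (metis R.star_closed R.one_closed R.r_one R.l_one)
  define m where "m = w \<otimes>\<^bsub>R\<^esub> star w"
  define n where "n = star v \<otimes>\<^bsub>R\<^esub> v"
  have mn: "m \<in> carrier R" "n \<in> carrier R" unfolding m_def n_def using wv s by blast+
  have "star w \<otimes>\<^bsub>R\<^esub> star v = \<one>\<^bsub>R\<^esub>"
    using R.star_mult[OF wv(2,1)] wv(4) star_one by metis
  then have "m \<otimes>\<^bsub>R\<^esub> n = \<one>\<^bsub>R\<^esub>"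
    unfolding m_def n_def using wv s by (metis R.m_assoc R.m_closed R.l_one)
  then have "fibre_sum (coord 0) (m \<otimes>\<^bsub>R\<^esub> n) = \<one>\<^bsub>QA\<^esub>"
    by (simp add: coord_simps Q8_def)
  moreover have "star m = m"
    unfolding m_def using R.star_mult[OF wv(1) s(1)] R.star_star[OF wv(1)] by simp
  ultimately have "quat_norm w \<otimes>\<^bsub>QA\<^esub> fibre_sum (coord 0) n = \<one>\<^bsub>QA\<^esub>"
    using self_adjoint_coord[of m] mn(1)
    by (simp add: fibre_sum_coord_mult quat_norm_def m_def[symmetric])
  moreover have "fibre_sum (coord 0) n \<in> carrier QA"
    using fibre_sum_keys[of n A] mn(2) by simp
  ultimately show ?thesis by blast
qed

text \<open>
  Wherever \<open>u^2 + v^2 = -1\<close>, the quaternion \<open>x = (1 + u i + v j) / 2\<close> is an idempotent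
  that is not self-adjoint. A projection \<open>p\<close> has an idempotent real coordinate \<open>z\<close> and no
  imaginary ones, so that the norm of \<open>x - p\<close> is
  \<open>(1/2 - z)^2 + (u^2 + v^2) / 4 = (1 + u^2 + v^2) / 4\<close>, whatever \<open>p\<close> is. This is annihilated
  by \<open>t\<close>, and \<open>x - p\<close> is not a unit.
\<close>

lemma not_star_clean_if_two_squares:
  assumes t: "t \<in> carrier QA" "t \<noteq> 0" and uv: "u \<in> carrier QA" "v \<in> carrier QA"
    and eq: "t \<otimes>\<^bsub>QA\<^esub> (\<one>\<^bsub>QA\<^esub> \<oplus>\<^bsub>QA\<^esub> u \<otimes>\<^bsub>QA\<^esub> u \<oplus>\<^bsub>QA\<^esub> v \<otimes>\<^bsub>QA\<^esub> v) = \<zero>\<^bsub>QA\<^esub>"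
  shows "\<not> star_clean R star"
proof
  assume clean: "star_clean R star"
  define h where "h = (\<lambda>y :: 'a \<Rightarrow>\<^sub>0 rat. scale_coeffs (1 / 2) y)"
  define L where "L = (\<lambda>q (y :: 'a \<Rightarrow>\<^sub>0 rat). linear_extension (Pair q) y :: quat \<times> 'a \<Rightarrow>\<^sub>0 rat)"
  define x where "x = L (1, 0, 0, 0) (h \<one>\<^bsub>QA\<^esub>) + L (0, 1, 0, 0) (h u) + L (0, 0, 1, 0) (h v)"
  have L: "L q y \<in> carrier R" if "q \<in> carrier Q8" "y \<in> carrier QA" for q y
    using that linear_extension_keys[of y "Pair q" "carrier (Q8 \<times>\<times> A)"] by (auto simp: L_def)
  have h: "h y \<in> carrier QA" if "y \<in> carrier QA" for y
    using that scale_coeffs_keys[of "1 / 2" y] by (auto simp: h_def)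
  have "x = L (1, 0, 0, 0) (h \<one>\<^bsub>QA\<^esub>) \<oplus>\<^bsub>R\<^esub> L (0, 1, 0, 0) (h u) \<oplus>\<^bsub>R\<^esub> L (0, 0, 1, 0) (h v)"
    by (simp add: x_def)
  moreover have "(1, 0, 0, 0) \<in> carrier Q8" "(0, 1, 0, 0) \<in> carrier Q8" "(0, 0, 1, 0) \<in> carrier Q8"
    by (simp_all add: Q8_def)
  ultimately have x: "x \<in> carrier R"
    using L h uv by (simp only: R.a_closed QA.one_closed)
  obtain w p where w: "w \<in> Units R" and p: "p \<in> projections R star" and xwp: "x = w \<oplus>\<^bsub>R\<^esub> p"
    using clean x unfolding star_clean_def by blast
  have p: "p \<in> carrier R" "p \<otimes>\<^bsub>R\<^esub> p = p" "star p = p"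
    using p by (auto simp: projections_def)
  have wR: "w \<in> carrier R" using w by (rule R.Units_closed)
  have w_eq: "w = x - p" using xwp by simp
  define z where "z = fibre_sum (coord 0) p"
  have z: "z \<in> carrier QA"
    unfolding z_def using fibre_sum_keys[of p A] p(1) by simp
  note p_coord = self_adjoint_coord[of p]
  have zz: "z \<otimes>\<^bsub>QA\<^esub> z = z"
  proof -
    have "z = fibre_sum (coord 0) (p \<otimes>\<^bsub>R\<^esub> p)"
      unfolding p(2) z_def ..
    also have "\<dots> = z \<otimes>\<^bsub>QA\<^esub> z"
      using p_coord p(1,3) by (simp add: fibre_sum_coord_mult z_def[symmetric])
    finally show ?thesis by (rule sym)
  qed
  have scale: "scale_coeffs 0 y = 0" "scale_coeffs 1 y = y" for y :: "'a \<Rightarrow>\<^sub>0 rat"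
    by (rule poly_mapping_eqI; simp add: lookup_scale_coeffs)+
  have w_coord: "fibre_sum (coord 0) w = h \<one>\<^bsub>QA\<^esub> - z" "fibre_sum (coord 1) w = h u"
    "fibre_sum (coord 2) w = h v" "fibre_sum (coord 3) w = 0"
    using p_coord p
    by (simp_all add: w_eq x_def L_def fibre_sum_diff fibre_sum_add fibre_sum_linear_extension_Pair
        coord_simps scale z_def del: group_ring_simps(2))
  have hz: "h z + h z = z"
    by (rule poly_mapping_eqI) (simp add: h_def lookup_scale_coeffs lookup_add)
  have "quat_norm w = (h \<one>\<^bsub>QA\<^esub> - z) \<otimes>\<^bsub>QA\<^esub> (h \<one>\<^bsub>QA\<^esub> - z) + h u \<otimes>\<^bsub>QA\<^esub> h u + h v \<otimes>\<^bsub>QA\<^esub> h v"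
    unfolding quat_norm_eq[OF wR] w_coord by simp
  also have "(h \<one>\<^bsub>QA\<^esub> - z) \<otimes>\<^bsub>QA\<^esub> (h \<one>\<^bsub>QA\<^esub> - z) = h (h \<one>\<^bsub>QA\<^esub>) - (h z + h z) + z"
    using QA.l_one[OF z] QA.r_one[OF z] QA.l_one[OF QA.one_closed]
    by (simp add: group_ring_diff_left group_ring_diff_right zz scale_coeffs_diff h_def group_ring_mult_scale_coeffs algebra_simps
       del: group_ring_simps(2))
  also have "\<dots> = h (h \<one>\<^bsub>QA\<^esub>)" by (simp add: hz)
  finally have "quat_norm w = h (h (\<one>\<^bsub>QA\<^esub> + u \<otimes>\<^bsub>QA\<^esub> u + v \<otimes>\<^bsub>QA\<^esub> v))"
    by (simp add: h_def scale_coeffs_add group_ring_mult_scale_coeffs del: group_ring_simps(2))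
  then have t_norm: "t \<otimes>\<^bsub>QA\<^esub> quat_norm w = 0"
    using eq by (simp add: h_def group_ring_mult_scale_coeffs)
  obtain y where y: "y \<in> carrier QA" "quat_norm w \<otimes>\<^bsub>QA\<^esub> y = \<one>\<^bsub>QA\<^esub>"
    using quat_norm_unit[OF w] by blast
  have "quat_norm w \<in> carrier QA"
    using R.m_closed[OF wR R.star_closed[OF wR]] fibre_sum_keys[of "w \<otimes>\<^bsub>R\<^esub> star w" A]
    by (simp add: quat_norm_def)
  then have "t = (t \<otimes>\<^bsub>QA\<^esub> quat_norm w) \<otimes>\<^bsub>QA\<^esub> y"
    using QA.m_assoc[OF t(1) _ y(1)] QA.r_one[OF t(1)] y(2) by metis
  then show False
    using t_norm t(2) by simp
qed

end

section \<open>Primes modulo 8\<close>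

theorem corollaryA:
  fixes A :: "('a, 'm) monoid_scheme" and G :: "(quat \<times> 'a) monoid"
    and QG :: "(quat \<times> 'a \<Rightarrow>\<^sub>0 rat) ring"
  assumes "comm_group A" and "finite (carrier A)"
    and "G = Q8 \<times>\<times> A" and "QG = group_ring G"
  shows "((\<exists>p x. prime (p::nat) \<and> (p mod 8 = 3 \<or> p mod 8 = 5) \<and>
              x \<in> carrier G \<and> group.ord G x = p)
           \<longrightarrow> \<not> star_clean QG (linear_extension (canonical_involution G)))
    \<and> ((\<exists>p. prime (p::nat) \<and> p mod 8 = 7 \<and> A \<cong> integer_mod_group p)
           \<longrightarrow> star_clean QG (linear_extension (canonical_involution G)))"
proof (intro conjI impI; elim exE conjE)
  interpret A: comm_group A by fact
  interpret G: group "Q8 \<times>\<times> A" by (intro DirProd_group group_Q8 A.is_group)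
  interpret QA: cring "group_ring A :: ('a \<Rightarrow>\<^sub>0 rat) ring"
    by (rule cring_group_ring) (rule A.comm_monoid_axioms)
  {
    fix p :: nat and x
    assume p: "prime p" "p mod 8 = 3 \<or> p mod 8 = 5" and x: "x \<in> carrier G" and ord: "group.ord G x = p"
    obtain q a where x_eq: "x = (q, a)" by (cases x)
    have qa: "q \<in> carrier Q8" "a \<in> carrier A" using x by (simp_all add: x_eq assms(3))
    have odd_p: "odd p" using p(2) by presburger
    have pow: "(q, a) [^]\<^bsub>Q8 \<times>\<times> A\<^esub> (n::nat) = (q [^]\<^bsub>Q8\<^esub> n, a [^]\<^bsub>A\<^esub> n)" for n
      by (induction n) (simp_all add: nat_pow_def)
    have "x [^]\<^bsub>Q8 \<times>\<times> A\<^esub> p = \<one>\<^bsub>Q8 \<times>\<times> A\<^esub>"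
      using G.pow_ord_eq_1[of x] x ord unfolding assms(3) by blast
    then have ap: "a [^]\<^bsub>A\<^esub> p = \<one>\<^bsub>A\<^esub>"
      by (simp add: x_eq pow)
    \<comment> \<open>\<open>Q\<^sub>8\<close> has exponent 4, so an element of odd order has a nontrivial component in \<open>A\<close>\<close>
    have "a \<noteq> \<one>\<^bsub>A\<^esub>"
    proof
      assume "a = \<one>\<^bsub>A\<^esub>"
      moreover have "q [^]\<^bsub>Q8\<^esub> (4::nat) = \<one>\<^bsub>Q8\<^esub>"
        using qa(1) by (auto simp: Q8_def nat_pow_def numeral_eq_Suc)
      ultimately have "x [^]\<^bsub>Q8 \<times>\<times> A\<^esub> (4::nat) = \<one>\<^bsub>Q8 \<times>\<times> A\<^esub>"
        unfolding x_eq pow by simp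
      then have "p dvd 4"
        using G.pow_eq_id[of x 4] x ord unfolding assms(3) by blast
      then have "p dvd 2 ^ 2" by simp
      then have "p dvd 2" using p(1) prime_dvd_power by blast
      then show False using p odd_p by (metis primes_dvd_imp_eq two_is_prime_nat even_iff_mod_2_eq_zero mod_self)
    qed
    define s where "s = (Poly_Mapping.single a 1 :: 'a \<Rightarrow>\<^sub>0 rat)"
    have s: "s \<in> carrier (group_ring A)" using qa by (simp add: s_def)
    have "s [^]\<^bsub>group_ring A\<^esub> p = \<one>\<^bsub>group_ring A\<^esub>"
      by (simp add: s_def group_ring_single_pow ap)
    then obtain u v where uv: "u \<in> carrier (group_ring A)" "v \<in> carrier (group_ring A)"
      "(\<one>\<^bsub>group_ring A\<^esub> \<ominus>\<^bsub>group_ring A\<^esub> s) \<otimes>\<^bsub>group_ring A\<^esub>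
        (\<one>\<^bsub>group_ring A\<^esub> \<oplus>\<^bsub>group_ring A\<^esub> u \<otimes>\<^bsub>group_ring A\<^esub> u \<oplus>\<^bsub>group_ring A\<^esub> v \<otimes>\<^bsub>group_ring A\<^esub> v) = \<zero>\<^bsub>group_ring A\<^esub>"
      using QA.minus_one_sum_of_two_squares[OF s _ odd_p dvd_two_power_half_plus_1[OF p]] by blast
    have "s \<noteq> \<one>\<^bsub>group_ring A\<^esub>"
    proof
      assume "s = \<one>\<^bsub>group_ring A\<^esub>"
      from arg_cong[OF this, of "\<lambda>y. Poly_Mapping.lookup y a"] \<open>a \<noteq> \<one>\<^bsub>A\<^esub>\<close> show False
        by (simp add: s_def lookup_single)
    qed
    then have "\<one>\<^bsub>group_ring A\<^esub> \<ominus>\<^bsub>group_ring A\<^esub> s \<noteq> 0"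
      using QA.r_right_minus_eq[OF QA.one_closed s] by auto
    then show "\<not> star_clean QG (linear_extension (canonical_involution G))"
      unfolding assms(3,4)
      by (rule not_star_clean_if_two_squares[OF assms(1) QA.minus_closed[OF QA.one_closed s] _ uv])
  next
    fix p :: nat
    assume p: "prime p" "p mod 8 = 7" and iso: "A \<cong> integer_mod_group p"
    have "odd ((p - 1) div 2)"
    proof -
      have "(p - 1) div 2 = 4 * (p div 8) + 3"
        using mult_div_mod_eq[of 8 p] p(2) by (intro div_nat_eqI) simp_all
      then show ?thesis by simp
    qed
    moreover have "g [^]\<^bsub>A\<^esub> ((2::nat) ^ ((p - 1) div 2)) = g" if g: "g \<in> carrier A" for g
    proof -
      have "card (carrier A) = p"
        using iso_same_card[OF iso] prime_gt_0_nat[OF p(1)] by (simp add: integer_mod_group_def)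
      then have gp: "g [^]\<^bsub>A\<^esub> p = \<one>\<^bsub>A\<^esub>"
        using A.pow_order_eq_1[OF g] by (simp add: order_def)
      obtain m where "2 ^ ((p - 1) div 2) - 1 = p * m"
        using dvd_two_power_half_minus_1[OF p] by blast
      then have "(2::nat) ^ ((p - 1) div 2) = Suc (p * m)"
        by (metis Suc_pred' nat_zero_less_power_iff pos2 diff_Suc_1 zero_less_numeral zero_less_power)
      then show ?thesis
        using g gp by (simp add: A.nat_pow_pow[symmetric])
    qed
    ultimately show "star_clean QG (linear_extension (canonical_involution G))"
      unfolding assms(3,4) by (intro star_clean_Q8_times[OF assms(1,2)])
  }
qed

end
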